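(* Let $\nu\in\{0,\tfrac12\}$, and let $N_1,\dots,N_6\in\mathbb{Z}+\nu$ and $a_1,\dots,a_6\in\mathbb{C}$ satisfy $$\sum_{k=1}^6 N_k=2,\qquad \sum_{k=1}^6 a_k=0 .$$ For $N\in\mathbb{Z}+\nu$ put $$F_N(y)=(y^2-N^2)\prod_{k=1}^6 \Big(1+\tfrac{a_k-N_k+(y-N)}{2}\Big)_{N_k-1+N}\Big(1+\tfrac{a_k-N_k-(y-N)}{2}\Big)_{N_k-1-N},$$ and let $C_N$ be a contour as described in the context. Then $$\frac{1}{8\pi{\rm i}}\sum_{N\in \mathbb{Z} +\nu}\int_{C_N} F_N(y)\, dy =\prod_{1\leq j< k \leq 6}\Big(1+\frac{a_j+ a_k-N_j-N_k}{2}\Big)_{N_j+N_k-1}.$$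
   Context: For $a\in\mathbb{C}$ and $n\in\mathbb{Z}$ the Pochhammer symbol is $(a)_n=\Gamma(a+n)/\Gamma(a)$, i.e. $(a)_0=1$, $(a)_n=a(a+1)\cdots(a+n-1)$ for $n>0$, and $(a)_n=1/\big((a-1)(a-2)\cdots(a+n)\big)$ for $n<0$. Since $N_k\pm N\in\mathbb{Z}$, all Pochhammer indices above are integers, so $F_N$ is a rational function of $y$. Its poles come either from the factors $\big(1+\tfrac{a_k-N_k+(y-N)}{2}\big)_{N_k-1+N}$ ("plus-sign" factors) or from the factors $\big(1+\tfrac{a_k-N_k-(y-N)}{2}\big)_{N_k-1-N}$ ("minus-sign" factors). The contour $C_N$ runs from $-\infty$ to $+\infty$, coinciding with the real axis outside a compact set, and separates the poles of the plus-sign factors (lying to its left, i.e. above it) from the poles of the minus-sign factors (lying to its right, i.e. below it); the parameters $a_k$ are assumed generic enough that such contours exist. Only finitely many terms of the sum over $N$ are nonzero. *)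

theory Defs
  imports "HOL-Complex_Analysis.Complex_Analysis"
begin

definition poch_int :: "complex \<Rightarrow> int \<Rightarrow> complex" where
  "poch_int a n = (if 0 \<le> n then pochhammer a (nat n)
                   else 1 / (\<Prod>j=1..nat (- n). (a - of_nat j)))"

text \<open>The integrand F_N(y). N and the N_k are real half-integers (N - N_k integral, etc.);
  the Pochhammer indices are integers and are converted with floor (which is exact).\<close>
definition F :: "(nat \<Rightarrow> real) \<Rightarrow> (nat \<Rightarrow> complex) \<Rightarrow> real \<Rightarrow> complex \<Rightarrow> complex" where
  "F Nk a N y = (y\<^sup>2 - (of_real N)\<^sup>2) *
     (\<Prod>k=1..6. poch_int (1 + (a k - of_real (Nk k) + (y - of_real N)) / 2) \<lfloor>Nk k - 1 + N\<rfloor>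
               * poch_int (1 + (a k - of_real (Nk k) - (y - of_real N)) / 2) \<lfloor>Nk k - 1 - N\<rfloor>)"

text \<open>Poles of the plus-sign factors: zeros of the denominators (a-1)...(a+n) for negative index n.\<close>
definition plus_poles :: "(nat \<Rightarrow> real) \<Rightarrow> (nat \<Rightarrow> complex) \<Rightarrow> real \<Rightarrow> complex set" where
  "plus_poles Nk a N = {y. \<exists>k\<in>{1..6}. \<exists>j::int. 1 \<le> j \<and> j \<le> - \<lfloor>Nk k - 1 + N\<rfloor> \<and>
        1 + (a k - of_real (Nk k) + (y - of_real N)) / 2 = of_int j}"

definition minus_poles :: "(nat \<Rightarrow> real) \<Rightarrow> (nat \<Rightarrow> complex) \<Rightarrow> real \<Rightarrow> complex set" where
  "minus_poles Nk a N = {y. \<exists>k\<in>{1..6}. \<exists>j::int. 1 \<le> j \<and> j \<le> - \<lfloor>Nk k - 1 - N\<rfloor> \<and>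
        1 + (a k - of_real (Nk k) - (y - of_real N)) / 2 = of_int j}"

text \<open>A contour from -\<infinity> to +\<infinity> that coincides with the real axis outside a compact set:
  (-\<infinity>,-R] followed by a valid path g from -R to R, followed by [R,+\<infinity>).\<close>
definition contour_set :: "real \<Rightarrow> (real \<Rightarrow> complex) \<Rightarrow> complex set" where
  "contour_set R g = path_image g \<union> {complex_of_real x | x. R \<le> \<bar>x\<bar>}"

definition contour_integral_line :: "(complex \<Rightarrow> complex) \<Rightarrow> real \<Rightarrow> (real \<Rightarrow> complex) \<Rightarrow> complex" where
  "contour_integral_line f R g =
     integral {..-R} (\<lambda>x. f (complex_of_real x)) + contour_integral g f
     + integral {R..} (\<lambda>x. f (complex_of_real x))"

definition above_contour :: "complex set \<Rightarrow> complex \<Rightarrow> bool" where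
  "above_contour S z \<longleftrightarrow> z \<notin> S \<and>
     (\<exists>K. (\<forall>w\<in>S. Im w < K) \<and> z \<in> connected_component_set (- S) (\<i> * of_real K))"

definition below_contour :: "complex set \<Rightarrow> complex \<Rightarrow> bool" where
  "below_contour S z \<longleftrightarrow> z \<notin> S \<and>
     (\<exists>K. (\<forall>w\<in>S. - K < Im w) \<and> z \<in> connected_component_set (- S) (- \<i> * of_real K))"

definition admissible_contour ::
  "(nat \<Rightarrow> real) \<Rightarrow> (nat \<Rightarrow> complex) \<Rightarrow> real \<Rightarrow> real \<Rightarrow> (real \<Rightarrow> complex) \<Rightarrow> bool" where
  "admissible_contour Nk a N R g \<longleftrightarrow>
     0 < R \<and> valid_path g \<and> pathstart g = - of_real R \<and> pathfinish g = of_real R \<and>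
     (\<forall>z\<in>plus_poles Nk a N. above_contour (contour_set R g) z) \<and>
     (\<forall>z\<in>minus_poles Nk a N. below_contour (contour_set R g) z)"

end

theory Submission
  imports Defs "HOL-Real_Asymp.Real_Asymp"
begin

text \<open>With \<open>w = y - N\<close>, \<open>\<alpha>\<^sub>k = (a\<^sub>k - N\<^sub>k) / 2\<close> and \<open>b\<^sub>k = \<alpha>\<^sub>k + N\<^sub>k\<close> the integrand is, for \<open>x = w / 2 + N\<close>,
  \<open>2 w x \<Prod>\<^sub>k \<Gamma>(b\<^sub>k \<plusminus> x) / \<Gamma>(1 + \<alpha>\<^sub>k \<plusminus> w / 2)\<close>. Closing the contour in the upper half plane turns
  the integral into \<open>2 \<pi> i\<close> times the sum of the residues at the plus poles. For generic \<open>\<alpha>\<close> these lie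
  in classes modulo 2 that do not depend on \<open>N\<close>, so that their sum is a linear functional which may be applied
  to identities between integrands with different \<open>N\<close>. Lower one of the \<open>N\<^sub>k\<close> by one, so that \<open>\<Sum> b\<^sub>k = 0\<close>. Then the polynomial identity
  \<open>(b\<^sub>i - b\<^sub>j) (\<Prod>\<^sub>k (b\<^sub>k + x) - \<Prod>\<^sub>k (b\<^sub>k - x))
    = 2 x (A (b\<^sub>i\<^sup>2 - x\<^sup>2) - B (b\<^sub>j\<^sup>2 - x\<^sup>2))\<close>, where \<open>A = \<Prod>\<^sub>l (b\<^sub>j + b\<^sub>l)\<close> and
  \<open>B = \<Prod>\<^sub>l (b\<^sub>i + b\<^sub>l)\<close> over \<open>l \<noteq> i, j\<close>, makes the combination of the integrands for \<open>N\<^sub>i + 1\<close> and for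
  \<open>N\<^sub>j + 1\<close> with coefficients \<open>A\<close> and \<open>- B\<close> telescope in \<open>N\<close>; the right-hand side
  satisfies the same recurrence. Keeping \<open>\<alpha>\<close> fixed, this reduces every \<open>(N\<^sub>1, \<dots>, N\<^sub>6)\<close> to one base case for each \<open>\<nu>\<close>,
  where only a few simple poles occur. Arbitrary parameters follow by perturbing \<open>a\<close> while keeping the contours fixed.\<close>

section \<open>Contours separating two finite sets\<close>

text \<open>On a large circle the residue theorem yields the whole sum, while decay faster than 1/z
  makes the integral arbitrarily small. This later trades residues at plus poles for residues at
  minus poles.\<close>

lemma sum_residues_eq_0:
  assumes "finite P" and f: "f holomorphic_on - P"
    and lim: "((\<lambda>z. z * f z) \<longlongrightarrow> 0) at_infinity"
  shows "(\<Sum>p\<in>P. residue f p) = 0"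
proof -
  have "norm (2 * pi * \<i> * (\<Sum>p\<in>P. residue f p)) \<le> 0 + \<delta>" if \<delta>: "\<delta> > 0" for \<delta>
  proof -
    define d where "d = \<delta> / (2 * pi)"
    have "d > 0" using \<delta> by (simp add: d_def)
    then obtain b where b: "\<And>z. norm z \<ge> b \<Longrightarrow> norm (z * f z) < d"
      using lim by (auto simp: tendsto_iff eventually_at_infinity dist_norm)
    obtain c where c: "\<And>p. p \<in> P \<Longrightarrow> norm p \<le> c"
      using finite_imp_bounded[OF \<open>finite P\<close>] by (auto simp: bounded_iff)
    \<comment> \<open>The circle has all of \<open>P\<close> inside and lies where the decay
      estimate holds; the bound 1 keeps the radius positive.\<close>
    define R where "R = max 1 (max b (c + 1))"
    have R: "R \<ge> 1" "R \<ge> b" "R \<ge> c + 1" by (auto simp: R_def)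
    have wn: "winding_number (circlepath 0 R) p = 1" if "p \<in> P" for p
      using c[OF that] R by (intro winding_number_circlepath) auto
    have im: "path_image (circlepath 0 R) \<subseteq> UNIV - P"
      using c R by (force simp: path_image_circlepath)
    have "contour_integral (circlepath 0 R) f =
          2 * pi * \<i> * (\<Sum>p\<in>P. winding_number (circlepath 0 R) p * residue f p)"
      using assms im by (intro Residue_theorem[where S = UNIV]) (auto simp: Compl_eq_Diff_UNIV)
    also have "\<dots> = 2 * pi * \<i> * (\<Sum>p\<in>P. residue f p)"
      by (simp add: wn)
    finally have eq: "contour_integral (circlepath 0 R) f = 2 * pi * \<i> * (\<Sum>p\<in>P. residue f p)" .
    have "open (- P)" using \<open>finite P\<close> by (simp add: finite_imp_closed open_Compl)
    then have "f contour_integrable_on circlepath 0 R"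
      using im f by (intro contour_integrable_holomorphic_simple[of f "- P"]) auto
    then have "(f has_contour_integral (contour_integral (circlepath 0 R) f)) (circlepath 0 R)"
      by (rule has_contour_integral_integral)
    then have "norm (contour_integral (circlepath 0 R) f) \<le> (d / R) * (2 * pi * R)"
    proof (rule has_contour_integral_bound_circlepath)
      fix x :: complex assume x: "norm (x - 0) = R"
      have "norm (x * f x) < d" using b x R by simp
      then show "norm (f x) \<le> d / R"
        using x R by (simp add: norm_mult field_simps)
    qed (use R \<open>d > 0\<close> in auto)
    also have "\<dots> = \<delta>" using R by (simp add: d_def)
    finally show ?thesis by (simp add: eq)
  qed
  then have "norm (2 * pi * \<i> * (\<Sum>p\<in>P. residue f p)) \<le> 0"
    by (rule field_le_epsilon)
  then show ?thesis by simp
qed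

lemma tendsto_times_from_square:
  fixes f :: "complex \<Rightarrow> complex"
  assumes "((\<lambda>z. z ^ 2 * f z) \<longlongrightarrow> 0) at_infinity"
  shows "((\<lambda>z. z * f z) \<longlongrightarrow> 0) at_infinity"
proof -
  have "((\<lambda>z. inverse z * (z ^ 2 * f z)) \<longlongrightarrow> 0 * 0) at_infinity"
    by (intro tendsto_mult assms tendsto_inverse_0)
  moreover have "\<forall>\<^sub>F z in at_infinity. inverse z * (z ^ 2 * f z) = z * f z"
    using eventually_not_equal_at_infinity[of 0] by eventually_elim (simp add: power2_eq_square)
  ultimately show ?thesis by (simp add: tendsto_cong)
qed

section \<open>Closing the contour by a semicircle and counting windings\<close>

definition line_path :: "(real \<Rightarrow> complex) \<Rightarrow> real \<Rightarrow> real \<Rightarrow> real \<Rightarrow> complex" where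
  "line_path g R r = linepath (- of_real r) (- of_real R) +++ g +++ linepath (of_real R) (of_real r)"

text \<open>Only \<open>t = pi\<close> (upper semicircle) and \<open>t = - pi\<close> (lower
  semicircle) are meant. Integrals are closed above; the lower closing helps to find winding numbers
  of the upper one.\<close>

definition closed_up :: "(real \<Rightarrow> complex) \<Rightarrow> real \<Rightarrow> real \<Rightarrow> real \<Rightarrow> real \<Rightarrow> complex" where
  "closed_up g R r t = line_path g R r +++ part_circlepath 0 r 0 t"

lemma valid_line_path:
  assumes "valid_path g" "pathstart g = - of_real R" "pathfinish g = of_real R"
  shows "valid_path (line_path g R r)" "pathstart (line_path g R r) = - of_real r"
    "pathfinish (line_path g R r) = of_real r"
  using assms by (auto simp: line_path_def intro!: valid_path_join)

lemma path_image_line_path: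
  assumes "valid_path g" "pathstart g = - of_real R" "pathfinish g = of_real R" "0 < R" "R \<le> r"
  shows "path_image (line_path g R r) \<subseteq> contour_set R g"
proof -
  have "path_image (linepath (- of_real r) (- of_real R)) \<subseteq> contour_set R g"
  proof
    fix w assume "w \<in> path_image (linepath (- complex_of_real r) (- of_real R))"
    then obtain x where x: "w = of_real x" "x \<in> closed_segment (- r) (- R)"
      by (auto simp: closed_segment_of_real simp flip: of_real_minus)
    then have "R \<le> \<bar>x\<bar>" using assms by (auto simp: closed_segment_eq_real_ivl)
    then show "w \<in> contour_set R g" using x(1) unfolding contour_set_def by blast
  qed
  moreover have "path_image (linepath (of_real R) (of_real r)) \<subseteq> contour_set R g"
  proof
    fix w assume "w \<in> path_image (linepath (complex_of_real R) (of_real r))"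
    then obtain x where x: "w = of_real x" "x \<in> closed_segment R r"
      by (auto simp: closed_segment_of_real)
    then have "R \<le> \<bar>x\<bar>" using assms by (auto simp: closed_segment_eq_real_ivl)
    then show "w \<in> contour_set R g" using x(1) unfolding contour_set_def by blast
  qed
  moreover have "path_image g \<subseteq> contour_set R g" by (auto simp: contour_set_def)
  ultimately show ?thesis
    using assms by (simp add: line_path_def path_image_join)
qed

lemma closed_contour_set:
  assumes "path g"
  shows "closed (contour_set R g)"
proof -
  have "{complex_of_real x | x. R \<le> \<bar>x\<bar>} = \<real> \<inter> {z. R \<le> norm z}"
    by (auto simp: Reals_def)
  moreover have "closed {z::complex. R \<le> norm z}"
    by (intro closed_Collect_le continuous_intros)
  ultimately have "closed {complex_of_real x | x. R \<le> \<bar>x\<bar>}"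
    by (simp add: closed_Int closed_complex_Reals)
  then show ?thesis
    unfolding contour_set_def using assms by (intro closed_Un closed_path_image) auto
qed

lemma closed_up_valid:
  assumes "valid_path g" "pathstart g = - of_real R" "pathfinish g = of_real R" "t = pi \<or> t = - pi"
  shows "valid_path (closed_up g R r t)"
    "pathfinish (closed_up g R r t) = pathstart (closed_up g R r t)"
proof -
  have *: "pathstart (part_circlepath 0 r 0 t) = of_real r"
          "pathfinish (part_circlepath 0 r 0 t) = - of_real r"
    using assms(4) by (auto simp: exp_minus mult.commute[of _ \<i>])
  show "valid_path (closed_up g R r t)"
    "pathfinish (closed_up g R r t) = pathstart (closed_up g R r t)"
    unfolding closed_up_def using valid_line_path[OF assms(1-3)] *
    by (auto intro!: valid_path_join simp del: pathstart_part_circlepath pathfinish_part_circlepath)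
qed

lemma path_image_closed_up:
  assumes "valid_path g" "pathstart g = - of_real R" "pathfinish g = of_real R" "0 < R" "R \<le> r"
  shows "path_image (closed_up g R r t) \<subseteq> contour_set R g \<union> path_image (part_circlepath 0 r 0 t)"
  unfolding closed_up_def
  using path_image_line_path[OF assms] valid_line_path[OF assms(1-3)]
  by (subst path_image_join) auto

lemma arc_up:
  assumes "0 \<le> r"
  shows "path_image (part_circlepath 0 r 0 pi) \<subseteq> sphere 0 r \<inter> {w. 0 \<le> Im w}"
  using assms by (auto simp: path_image_part_circlepath' closed_segment_eq_real_ivl norm_mult
      intro!: mult_nonneg_nonneg sin_ge_zero)

lemma arc_down:
  assumes "0 \<le> r"
  shows "path_image (part_circlepath 0 r 0 (- pi)) \<subseteq> sphere 0 r \<inter> {w. Im w \<le> 0}"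
proof -
  have "r * sin x \<le> 0" if "-pi \<le> x" "x \<le> 0" for x
    using sin_ge_zero[of "-x"] that assms by (simp add: mult_nonneg_nonpos)
  then show ?thesis using assms
    by (auto simp: path_image_part_circlepath' closed_segment_eq_real_ivl norm_mult)
qed

text \<open>The upper semicircle followed by the reversed lower one is the full circle, which winds
  once around every point of the disc.\<close>

lemma winding_difference:
  assumes "valid_path g" "pathstart g = - of_real R" "pathfinish g = of_real R" "0 < R" "R \<le> r"
    and z: "z \<notin> contour_set R g" "norm z < r"
  shows "winding_number (closed_up g R r pi) z = winding_number (closed_up g R r (- pi)) z + 1"
proof -
  let ?l = "line_path g R r"
  let ?C = "circlepath 0 r"
  have nl: "z \<notin> path_image ?l"
    using path_image_line_path[OF assms(1-5)] z by auto
  have vl: "path ?l" "pathfinish ?l = of_real r"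
    using valid_line_path[OF assms(1-3)] valid_path_imp_path by auto
  have na: "z \<notin> path_image (part_circlepath 0 r 0 t)" for t
    using path_image_part_circlepath_subset'[of r 0 0 t] assms by (auto simp: subset_iff)
  have w: "winding_number (closed_up g R r t) z =
      winding_number ?l z + winding_number (part_circlepath 0 r 0 t) z" for t
    unfolding closed_up_def
    by (rule winding_number_join) (use vl nl na in \<open>auto simp: valid_path_imp_path\<close>)
  have nC: "z \<notin> path_image ?C" using assms by (auto simp: path_image_circlepath)
  have s1: "subpath 0 (1/2) ?C = part_circlepath 0 r 0 pi"
    by (auto simp: subpath_def circlepath_def part_circlepath_def linepath_def fun_eq_iff)
  \<comment> \<open>Run backwards from 1 to 1/2, the circle passes from angle 2 pi to pi; by
    periodicity this is the arc from 0 to - pi.\<close>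
  have s2: "subpath 1 (1/2) ?C = part_circlepath 0 r 0 (- pi)"
  proof
    fix x
    have "exp (2 * complex_of_real pi * \<i> - w) = exp (- w)" for w
      by (simp add: exp_diff exp_minus field_simps)
    then show "subpath 1 (1/2) ?C x = part_circlepath 0 r 0 (- pi) x"
      by (simp add: subpath_def circlepath_def part_circlepath_def linepath_def algebra_simps)
  qed
  have "winding_number (subpath 0 (1/2) ?C) z + winding_number (subpath (1/2) 1 ?C) z =
        winding_number (subpath 0 1 ?C) z"
    by (rule winding_number_subpath_combine) (use nC in auto)
  moreover have "winding_number (subpath (1/2) 1 ?C) z = - winding_number (subpath 1 (1/2) ?C) z"
  proof -
    have eq: "subpath (1/2) 1 ?C = reversepath (subpath 1 (1/2) ?C)" by (simp add: reversepath_subpath)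
    show ?thesis
      unfolding eq s2 by (rule winding_number_reversepath) (use na in auto)
  qed
  moreover have "winding_number ?C z = 1"
    using assms by (intro winding_number_circlepath) auto
  ultimately show ?thesis by (simp add: w s1 s2 algebra_simps)
qed

text \<open>Inside the complement of the contour, \<open>z\<close> can be moved to \<open>u\<close>,
  which lies outside a convex set containing the closed path. For large \<open>r\<close> the
  semicircle stays clear of the connecting path, so the winding number does not change on the way.
  In the applications \<open>C\<close> is a half plane.\<close>

lemma winding_closed_up_0:
  assumes g: "valid_path g" "pathstart g = - of_real R" "pathfinish g = of_real R" "0 < R"
    and z: "u \<in> connected_component_set (- contour_set R g) z"
    and t: "t = pi \<or> t = - pi"
    and C: "convex C" "u \<notin> C"
      "\<And>r. r > 0 \<Longrightarrow> contour_set R g \<union> path_image (part_circlepath 0 r 0 t) \<subseteq> C"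
  shows "\<forall>\<^sub>F r in at_top. winding_number (closed_up g R r t) z = 0"
proof -
  let ?S = "contour_set R g"
  have "open (- ?S)"
    using closed_contour_set g(1) valid_path_imp_path by blast
  then have "path_component (- ?S) z u"
    using z by (metis mem_Collect_eq open_path_connected_component)
  then obtain h where h: "path h" "path_image h \<subseteq> - ?S" "pathstart h = z" "pathfinish h = u"
    by (auto simp: path_component_def)
  obtain b where b: "\<And>w. w \<in> path_image h \<Longrightarrow> norm w \<le> b"
    using bounded_path_image[OF h(1)] by (auto simp: bounded_iff)
  show ?thesis
    using eventually_gt_at_top[of b] eventually_ge_at_top[of R] eventually_gt_at_top[of 0]
  proof eventually_elim
    case (elim r)
    let ?\<gamma> = "closed_up g R r t"
    have v: "valid_path ?\<gamma>" "pathfinish ?\<gamma> = pathstart ?\<gamma>"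
      using closed_up_valid[OF g(1-3) t] by auto
    have sub: "path_image ?\<gamma> \<subseteq> ?S \<union> path_image (part_circlepath 0 r 0 t)"
      using path_image_closed_up g elim by blast
    have "path_image (part_circlepath 0 r 0 t) \<subseteq> sphere 0 r"
      using elim by (intro path_image_part_circlepath_subset') auto
    then have dis: "path_image h \<inter> path_image ?\<gamma> = {}"
      using sub h(2) b elim by fastforce
    have "winding_number ?\<gamma> z = winding_number ?\<gamma> u"
      by (rule winding_number_eq[of _ _ "path_image h"])
         (use v h dis connected_path_image in \<open>auto simp: valid_path_imp_path\<close>)
    also have "\<dots> = 0"
      by (rule winding_number_zero_outside[of _ C])
         (use v C sub elim in \<open>auto simp: valid_path_imp_path\<close>)
    finally show ?case .
  qed
qed

text \<open>A point below the contour can be moved down, out of the upper closing. A point above it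
  can be moved up, out of the lower closing; its winding number there is 0, and
  \<open>winding_difference\<close> turns this into 1 for the upper closing.\<close>

lemma
  assumes g: "valid_path g" "pathstart g = - of_real R" "pathfinish g = of_real R" "0 < R"
  shows winding_below: "below_contour (contour_set R g) z \<Longrightarrow>
      \<forall>\<^sub>F r in at_top. winding_number (closed_up g R r pi) z = 0"
    and winding_above: "above_contour (contour_set R g) z \<Longrightarrow>
      \<forall>\<^sub>F r in at_top. winding_number (closed_up g R r pi) z = 1"
proof -
  let ?S = "contour_set R g"
  have RS: "complex_of_real R \<in> ?S" using g by (auto simp: contour_set_def)
  {
    assume "below_contour ?S z"
    then obtain K where K: "\<forall>w\<in>?S. - K < Im w" "z \<in> connected_component_set (- ?S) (- \<i> * of_real K)"
      by (auto simp: below_contour_def)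
    \<comment> \<open>The contour contains the real point \<open>R\<close>. Positivity of
      \<open>K\<close> then puts the upper semicircle into the same half plane as the
      contour.\<close>
    have "0 < K" using K(1) RS by force
    have "path_image (part_circlepath 0 r 0 pi) \<subseteq> {w. - K < Im w}" if "r > 0" for r
      using arc_up[of r] that \<open>0 < K\<close> by force
    then show "\<forall>\<^sub>F r in at_top. winding_number (closed_up g R r pi) z = 0"
      using g K by (intro winding_closed_up_0[where C = "{w. - K < Im w}" and u = "- \<i> * of_real K"])
        (auto simp: connected_component_sym_eq convex_halfspace_Im_gt)
  }
  {
    assume ab: "above_contour ?S z"
    then obtain K where K: "\<forall>w\<in>?S. Im w < K" "z \<in> connected_component_set (- ?S) (\<i> * of_real K)"
      by (auto simp: above_contour_def)
    have "0 < K" using K(1) RS by force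
    have "path_image (part_circlepath 0 r 0 (- pi)) \<subseteq> {w. Im w < K}" if "r > 0" for r
      using arc_down[of r] that \<open>0 < K\<close> by force
    then have "\<forall>\<^sub>F r in at_top. winding_number (closed_up g R r (- pi)) z = 0"
      using g K by (intro winding_closed_up_0[where C = "{w. Im w < K}" and u = "\<i> * of_real K"])
        (auto simp: connected_component_sym_eq convex_halfspace_Im_lt)
    then show "\<forall>\<^sub>F r in at_top. winding_number (closed_up g R r pi) z = 1"
      using eventually_gt_at_top[of "norm z"] eventually_ge_at_top[of R]
    proof eventually_elim
      case (elim r)
      then show ?case
        using winding_difference[OF g, of r z] ab by (simp add: above_contour_def)
    qed
  }
qed

section \<open>From truncated contours to the whole line\<close>

text \<open>Dominated convergence: the integrand cut off outside \<open>{- (R + n)..R + n}\<close>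
  has the integrable majorant C / x^2 on each half-line.\<close>

lemma tail_integral:
  fixes f :: "real \<Rightarrow> complex"
  assumes R: "0 < R" and cont: "continuous_on {x. R \<le> \<bar>x\<bar>} f"
    and bound: "\<And>x. R \<le> \<bar>x\<bar> \<Longrightarrow> norm (f x) \<le> C / x^2"
  shows "(\<lambda>n. integral {R..R + real n} f) \<longlonglongrightarrow> integral {R..} f"
    "(\<lambda>n. integral {- (R + real n)..- R} f) \<longlonglongrightarrow> integral {..- R} f"
proof -
  have h1: "((\<lambda>x. C * (1 / x^2)) has_integral C * (1 / R)) {R..}"
    using has_integral_mult_right[OF has_integral_inverse_power_to_inf[of 2 R], of C] R by simp
  have C: "0 \<le> C / x^2" if "R \<le> \<bar>x\<bar>" for x
    using bound[OF that] norm_ge_zero[of "f x"] by linarith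
  have "(\<lambda>x. C / x^2) absolutely_integrable_on {R..}"
    using h1 C by (intro nonnegative_absolutely_integrable_1) (auto simp: integrable_on_def)
  then have "(\<lambda>x. C / (- x)^2) absolutely_integrable_on {..- R}"
    using has_absolute_integral_reflect_real[of "{..- R}" "{R..}" "\<lambda>x. C / x^2"
      "integral {R..} (\<lambda>x. C / x^2)"] by (simp add: image_subset_iff)
  then have h2: "(\<lambda>x. C / x^2) integrable_on {..- R}"
    by (simp add: absolutely_integrable_on_def)
  have lim: "(\<lambda>n. integral S (\<lambda>x. if x \<in> {- (R + real n)..R + real n} then f x else 0)) \<longlonglongrightarrow> integral S f"
    if S: "S \<subseteq> {x. R \<le> \<bar>x\<bar>}" and int: "\<And>n. f integrable_on (S \<inter> {- (R + real n)..R + real n})"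
      and h: "(\<lambda>x. C / x^2) integrable_on S" for S
  proof (rule dominated_convergence(2)[OF _ h])
    show "(\<lambda>x. if x \<in> {- (R + real n)..R + real n} then f x else 0) integrable_on S" for n
      using int[of n] by (subst integrable_restrict_Int) (simp add: Int_commute)
    fix n x assume "x \<in> S"
    then show "norm (if x \<in> {- (R + real n)..R + real n} then f x else 0) \<le> C / x\<^sup>2"
      using bound C S by auto
  next
    fix x assume "x \<in> S"
    have "\<forall>\<^sub>F n in sequentially. (if x \<in> {- (R + real n)..R + real n} then f x else 0) = f x"
      using eventually_ge_at_top[of "nat \<lceil>\<bar>x\<bar>\<rceil>"]
    proof eventually_elim
      case (elim n)
      then have "\<bar>x\<bar> \<le> real n" by linarith
      then show ?case using R by auto
    qed
    then show "(\<lambda>n. if x \<in> {- (R + real n)..R + real n} then f x else 0) \<longlonglongrightarrow> f x"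
      by (rule tendsto_eventually)
  qed
  have e1: "{R..} \<inter> {- (R + real n)..R + real n} = {R..R + real n}" for n using R by auto
  have e2: "{..- R} \<inter> {- (R + real n)..R + real n} = {- (R + real n)..- R}" for n using R by auto
  have i: "integral S (\<lambda>x. if x \<in> T then f x else 0) = integral (S \<inter> T) f" for S T
    by (simp add: integral_restrict_Int Int_commute)
  have c1: "f integrable_on {R..R + real n}" for n
    by (intro integrable_continuous_real continuous_on_subset[OF cont]) auto
  have c2: "f integrable_on {- (R + real n)..- R}" for n
    by (intro integrable_continuous_real continuous_on_subset[OF cont]) (use R in auto)
  have "(\<lambda>x. C / x^2) integrable_on {R..}"
    using h1 by (auto simp: integrable_on_def)
  then show "(\<lambda>n. integral {R..R + real n} f) \<longlonglongrightarrow> integral {R..} f"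
    using lim[of "{R..}"] c1 R unfolding i e1 by (simp add: subset_iff)
  show "(\<lambda>n. integral {- (R + real n)..- R} f) \<longlonglongrightarrow> integral {..- R} f"
    using lim[of "{..- R}"] h2 c2 R unfolding i e2 by (simp add: subset_iff)
qed

text \<open>Far out the bound comes from the decay of z^2 f(z), and on the remaining compact set
  from continuity.\<close>

lemma inverse_square_bound:
  fixes f :: "complex \<Rightarrow> complex"
  assumes R: "0 < R" and cont: "continuous_on {x. R \<le> \<bar>x\<bar>} (\<lambda>x. f (of_real x))"
    and lim: "((\<lambda>z. z^2 * f z) \<longlongrightarrow> 0) at_infinity"
  obtains C where "\<And>x::real. R \<le> \<bar>x\<bar> \<Longrightarrow> norm (f (of_real x)) \<le> C / x^2"
proof -
  obtain b where b: "\<And>z. norm z \<ge> b \<Longrightarrow> norm (z^2 * f z) < 1"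
    using lim zero_less_one by (force simp: tendsto_iff eventually_at_infinity dist_norm)
  let ?K = "{R..b} \<union> {- b..- R}"
  have "continuous_on ?K (\<lambda>x. f (of_real x))"
    using R by (intro continuous_on_subset[OF cont]) auto
  then have "continuous_on ?K (\<lambda>x. of_real x ^ 2 * f (of_real x))"
    by (rule continuous_on_mult[rotated]) (intro continuous_intros)
  then have "compact ((\<lambda>x. of_real x ^ 2 * f (of_real x)) ` ?K)"
    by (rule compact_continuous_image) (intro compact_Un compact_Icc)
  then have "bounded ((\<lambda>x. of_real x ^ 2 * f (of_real x)) ` ?K)"
    by (rule compact_imp_bounded)
  then obtain B where B: "\<forall>y\<in>(\<lambda>x. of_real x ^ 2 * f (of_real x)) ` ?K. norm y \<le> B"
    unfolding bounded_iff by (elim exE)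
  have "norm (f (of_real x)) \<le> max 1 B / x^2" if "R \<le> \<bar>x\<bar>" for x
  proof -
    have "norm (of_real x ^ 2 * f (of_real x)) \<le> max 1 B"
    proof (cases "b \<le> \<bar>x\<bar>")
      case True
      then show ?thesis using b[of "of_real x"] by simp
    next
      case False
      then have "x \<in> ?K" using that by auto
      then show ?thesis using bspec[OF B imageI] by fastforce
    qed
    moreover have "x^2 > 0" using R that by auto
    ultimately show ?thesis by (simp add: norm_mult norm_power field_simps)
  qed
  then show ?thesis using that by blast
qed

text \<open>The index \<open>Suc n\<close> keeps the two added real segments nondegenerate, so that
  their contour integrals can be rewritten as real integrals.\<close>

lemma contour_integral_line_path_tendsto:
  assumes g: "valid_path g" "pathstart g = - of_real R" "pathfinish g = of_real R" "0 < R"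
    and P: "finite P" "P \<inter> contour_set R g = {}" and f: "f holomorphic_on - P"
    and lim: "((\<lambda>z. z^2 * f z) \<longlongrightarrow> 0) at_infinity"
  shows "(\<lambda>n. contour_integral (line_path g R (R + real (Suc n))) f) \<longlonglongrightarrow> contour_integral_line f R g"
proof -
  have op: "open (- P)" using P by (simp add: finite_imp_closed open_Compl)
  have tail: "of_real x \<in> - P" if "R \<le> \<bar>x\<bar>" for x :: real
    using P(2) that by (auto simp: contour_set_def)
  have cont: "continuous_on {x. R \<le> \<bar>x\<bar>} (\<lambda>x. f (of_real x))"
    by (rule continuous_on_compose2[OF holomorphic_on_imp_continuous_on[OF f]])
       (use tail in \<open>auto intro!: continuous_intros\<close>)
  obtain C where C: "\<And>x::real. R \<le> \<bar>x\<bar> \<Longrightarrow> norm (f (of_real x)) \<le> C / x^2"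
    using inverse_square_bound[OF g(4) cont lim] by blast
  note t = tail_integral[OF g(4) cont C, THEN LIMSEQ_Suc]
  have fi: "f contour_integrable_on p" if "valid_path p" "path_image p \<subseteq> contour_set R g" for p
    using f op that P(2) by (intro contour_integrable_holomorphic_simple[of f "- P"]) auto
  have "contour_integral (line_path g R (R + real (Suc n))) f =
      integral {- (R + real (Suc n))..- R} (\<lambda>x. f (of_real x)) + contour_integral g f +
      integral {R..R + real (Suc n)} (\<lambda>x. f (of_real x))" for n
  proof -
    let ?r = "R + real (Suc n)"
    let ?a = "linepath (- complex_of_real ?r) (- of_real R)"
    let ?b = "linepath (complex_of_real R) (of_real ?r)"
    have "path_image (line_path g R ?r) = path_image ?a \<union> path_image g \<union> path_image ?b"
      unfolding line_path_def using g by (simp add: path_image_join Un_assoc)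
    then have sub: "path_image ?a \<union> path_image g \<union> path_image ?b \<subseteq> contour_set R g"
      using path_image_line_path[OF g, of ?r] by auto
    have i: "f contour_integrable_on ?a" "f contour_integrable_on g" "f contour_integrable_on ?b"
      using sub g by (auto intro!: fi)
    have "contour_integral (line_path g R ?r) f =
        contour_integral ?a f + (contour_integral g f + contour_integral ?b f)"
      unfolding line_path_def using i g
      by (simp add: contour_integrable_joinI valid_path_join)
    moreover have "contour_integral ?a f = integral {- ?r..- R} (\<lambda>x. f (of_real x))"
      by (subst contour_integral_linepath_Reals_eq) (auto simp flip: of_real_minus of_real_add)
    moreover have "contour_integral ?b f = integral {R..?r} (\<lambda>x. f (of_real x))"
      by (subst contour_integral_linepath_Reals_eq) auto
    ultimately show ?thesis by simp
  qed
  then show ?thesis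
    unfolding contour_integral_line_def using t by (auto intro!: tendsto_intros)
qed

text \<open>Besides the residue formula for the line integral, this supplies one closed path for
  each \<open>n\<close>, to be kept fixed when the parameters are perturbed.\<close>

lemma eventually_separating:
  assumes g: "valid_path g" "pathstart g = - of_real R" "pathfinish g = of_real R" "0 < R"
    and fin: "finite P" "finite M"
    and P: "\<forall>p\<in>P. above_contour (contour_set R g) p"
    and M: "\<forall>p\<in>M. below_contour (contour_set R g) p"
  shows "\<forall>\<^sub>F r in at_top. path_image (closed_up g R r pi) \<inter> (P \<union> M) = {} \<and>
    (\<forall>p\<in>P. winding_number (closed_up g R r pi) p = 1) \<and>
    (\<forall>p\<in>M. winding_number (closed_up g R r pi) p = 0)"
proof -
  obtain b where b: "\<And>p. p \<in> P \<union> M \<Longrightarrow> norm p \<le> b"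
    using finite_imp_bounded[of "P \<union> M"] fin by (auto simp: bounded_iff)
  have dis: "(P \<union> M) \<inter> contour_set R g = {}"
    using P M by (auto simp: above_contour_def below_contour_def)
  have "\<forall>\<^sub>F r in at_top. path_image (closed_up g R r pi) \<inter> (P \<union> M) = {}"
    using eventually_gt_at_top[of b] eventually_ge_at_top[of R]
  proof eventually_elim
    case (elim r)
    have "path_image (part_circlepath 0 r 0 pi) \<subseteq> - (P \<union> M)"
      using path_image_part_circlepath_subset'[of r 0 0 pi] elim g b by fastforce
    then show ?case
      using path_image_closed_up[OF g, of r pi] elim dis by blast
  qed
  then show ?thesis
    using fin P M winding_above[OF g] winding_below[OF g]
    by (intro eventually_conj eventually_ball_finite) auto
qed

text \<open>Closing above picks up winding number 1 at \<open>P\<close> and 0 at \<open>M\<close>,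
  and the arc contributes nothing in the limit. The two winding numbers differ, so no point lies in
  both sets; this disjointness later keeps the right-hand side free of zero denominators.\<close>

lemma contour_integral_line_residues:
  assumes g: "valid_path g" "pathstart g = - of_real R" "pathfinish g = of_real R" "0 < R"
    and fin: "finite P" "finite M"
    and P: "\<forall>p\<in>P. above_contour (contour_set R g) p"
    and M: "\<forall>p\<in>M. below_contour (contour_set R g) p"
    and f: "f holomorphic_on - (P \<union> M)"
    and lim: "((\<lambda>z. z^2 * f z) \<longlongrightarrow> 0) at_infinity"
  shows "contour_integral_line f R g = 2 * pi * \<i> * (\<Sum>p\<in>P. residue f p)"
    "P \<inter> M = {}"
proof -
  let ?S = "contour_set R g"
  let ?Q = "P \<union> M"
  have dis: "?Q \<inter> ?S = {}" using P M by (auto simp: above_contour_def below_contour_def)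
  have op: "open (- ?Q)"
    by (intro open_Compl finite_imp_closed) (use fin in auto)
  note ev = eventually_separating[OF g fin P M]
  obtain r where "(\<forall>p\<in>P. winding_number (closed_up g R r pi) p = 1) \<and>
       (\<forall>p\<in>M. winding_number (closed_up g R r pi) p = 0)"
    using eventually_happens'[OF _ ev] by auto
  then show PM: "P \<inter> M = {}" by fastforce
  let ?arc = "\<lambda>r. contour_integral (part_circlepath 0 r 0 pi) f"
  let ?I = "2 * pi * \<i> * (\<Sum>p\<in>P. residue f p)"
  have eq: "\<forall>\<^sub>F r in at_top. contour_integral (line_path g R r) f + ?arc r = ?I \<and>
      f contour_integrable_on part_circlepath 0 r 0 pi"
    using ev eventually_ge_at_top[of R]
  proof eventually_elim
    case (elim r)
    let ?\<gamma> = "closed_up g R r pi"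
    have v: "valid_path ?\<gamma>" "pathfinish ?\<gamma> = pathstart ?\<gamma>"
      using closed_up_valid[OF g(1-3)] by auto
    have im: "path_image ?\<gamma> \<subseteq> - ?Q" using elim by blast
    moreover have "path_image ?\<gamma> = path_image (line_path g R r) \<union> path_image (part_circlepath 0 r 0 pi)"
      unfolding closed_up_def using valid_line_path[OF g(1-3)] by (intro path_image_join) simp
    ultimately have a: "path_image (part_circlepath 0 r 0 pi) \<subseteq> - ?Q" by blast
    have "contour_integral ?\<gamma> f = 2 * pi * \<i> * (\<Sum>p\<in>?Q. winding_number ?\<gamma> p * residue f p)"
      using v f fin im by (intro Residue_theorem[where S = UNIV]) (auto simp: Compl_eq_Diff_UNIV)
    also have "(\<Sum>p\<in>?Q. winding_number ?\<gamma> p * residue f p) = (\<Sum>p\<in>P. residue f p)"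
      using elim fin PM by (simp add: sum.union_disjoint)
    finally have 1: "contour_integral ?\<gamma> f = ?I" .
    have l: "f contour_integrable_on line_path g R r" "valid_path (line_path g R r)"
      using valid_line_path[OF g(1-3)] path_image_line_path[OF g, of r] elim dis op f
      by (auto intro!: contour_integrable_holomorphic_simple[of f "- ?Q"])
    have c: "f contour_integrable_on part_circlepath 0 r 0 pi"
      using a op f by (auto intro!: contour_integrable_holomorphic_simple[of f "- ?Q"])
    show ?case
      using 1 l c unfolding closed_up_def by simp
  qed
  note lim0 = tendsto_times_from_square[OF lim]
  have arc0: "(?arc \<longlongrightarrow> 0) at_top"
  proof (rule tendstoI)
    fix e :: real assume "e > 0"
    then have "e / (2 * pi) > 0" by simp
    then obtain c where c: "\<And>z. norm z \<ge> c \<Longrightarrow> norm (z * f z) < e / (2 * pi)"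
      using lim0 by (force simp: tendsto_iff eventually_at_infinity dist_norm)
    show "\<forall>\<^sub>F r in at_top. dist (?arc r) 0 < e"
      using eq eventually_ge_at_top[of c] eventually_gt_at_top[of 0]
    proof eventually_elim
      case (elim r)
      have "norm (?arc r) \<le> (e / (2 * pi) / r) * r * (pi - 0)"
      proof (rule has_contour_integral_bound_part_circlepath)
        show "(f has_contour_integral ?arc r) (part_circlepath 0 r 0 pi)"
          using elim by (intro has_contour_integral_integral) auto
        fix x assume "x \<in> path_image (part_circlepath 0 r 0 pi)"
        then have x: "norm x = r"
          using path_image_part_circlepath_subset'[of r 0 0 pi] elim by auto
        then have "norm (x * f x) < e / (2 * pi)" using c elim by auto
        then show "norm (f x) \<le> e / (2 * pi) / r"
          using x elim by (simp add: norm_mult field_simps)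
      qed (use elim \<open>e > 0\<close> in auto)
      also have "\<dots> = e / 2" using elim by simp
      finally show ?case using \<open>e > 0\<close> by simp
    qed
  qed
  have sub: "filterlim (\<lambda>n. R + real (Suc n)) at_top sequentially"
    by real_asymp
  have "\<forall>\<^sub>F n in sequentially. ?I - ?arc (R + real (Suc n)) = contour_integral (line_path g R (R + real (Suc n))) f"
    using eventually_compose_filterlim[OF eq sub] by eventually_elim (auto simp: algebra_simps)
  moreover have "(\<lambda>n. ?I - ?arc (R + real (Suc n))) \<longlonglongrightarrow> ?I - 0"
    by (intro tendsto_diff tendsto_const filterlim_compose[OF arc0 sub])
  ultimately have "(\<lambda>n. contour_integral (line_path g R (R + real (Suc n))) f) \<longlonglongrightarrow> ?I"
    by (simp add: tendsto_cong)
  then show "contour_integral_line f R g = ?I"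
    using contour_integral_line_path_tendsto[OF g _ dis f lim] fin LIMSEQ_unique by blast
qed

section \<open>Generalized Pochhammer symbols\<close>

lemma poch_int_0: "poch_int c 0 = 1"
  by (simp add: poch_int_def)

lemma poch_int_minus_1: "poch_int c (- 1) = 1 / (c - 1)"
  by (simp add: poch_int_def)

lemma poch_int_minus_2: "poch_int c (- 2) = 1 / ((c - 1) * (c - 2))"
  by (simp add: poch_int_def numeral_2_eq_2)

lemma poch_int_1: "poch_int c 1 = c"
  by (simp add: poch_int_def)

text \<open>For negative \<open>n\<close> the factor \<open>c + n\<close> is the last one of the
  denominator and cancels. It must be nonzero: division by zero gives 0, and the recurrence could
  fail.\<close>

lemma poch_int_add_1:
  assumes "c + of_int n \<noteq> 0"
  shows "poch_int c (n + 1) = (c + of_int n) * poch_int c n"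
proof (cases "0 \<le> n")
  case True
  then show ?thesis
    by (simp add: poch_int_def nat_add_distrib pochhammer_Suc mult.commute)
next
  case False
  then obtain m where m: "n = - int (Suc m)"
    by (metis not_le zero_less_imp_eq_int neg_0_less_iff_less minus_minus int_cases3 negD)
  show ?thesis
  proof (cases m)
    case 0
    then show ?thesis using assms m by (simp add: poch_int_def)
  next
    case (Suc l)
    have n: "nat (- n) = Suc m" "nat (- (n + 1)) = m" "\<not> 0 \<le> n" "\<not> 0 \<le> n + 1"
      using m Suc by auto
    have d: "c - of_nat (Suc m) = c + of_int n"
      by (simp add: m)
    have "(\<Prod>j=1..Suc m. c - of_nat j) = (\<Prod>j=1..m. c - of_nat j) * (c + of_int n)"
      unfolding d[symmetric] by simp
    then show ?thesis using assms n
      by (simp add: poch_int_def del: prod.cl_ivl_Suc)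
  qed
qed

lemma poch_int_denominator_nonzero:
  fixes c :: complex
  assumes "\<forall>j. 1 \<le> j \<and> j \<le> - n \<longrightarrow> c \<noteq> of_int j" "\<not> 0 \<le> n"
  shows "(\<Prod>j=1..nat (- n). (c - of_nat j)) \<noteq> 0"
proof -
  have "c \<noteq> of_nat j" if "j \<in> {1..nat (- n)}" for j
  proof -
    have "1 \<le> int j" "int j \<le> - n" using that by auto
    then show ?thesis using assms(1)[rule_format, of "int j"] by simp
  qed
  then show ?thesis by auto
qed

lemma holomorphic_on_poch_int:
  assumes "f holomorphic_on A"
    and "\<And>w j. w \<in> A \<Longrightarrow> 1 \<le> j \<Longrightarrow> j \<le> - n \<Longrightarrow> f w \<noteq> of_int j"
  shows "(\<lambda>w. poch_int (f w) n) holomorphic_on A"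
proof (cases "0 \<le> n")
  case True
  then show ?thesis
    using assms by (simp add: poch_int_def pochhammer_prod) (intro holomorphic_intros)
next
  case False
  then have "(\<lambda>w. 1 / (\<Prod>j=1..nat (- n). (f w - of_nat j))) holomorphic_on A"
    using assms poch_int_denominator_nonzero[of n "f _"] by (intro holomorphic_intros) auto
  then show ?thesis using False by (simp add: poch_int_def)
qed

lemma tendsto_poch_int:
  assumes "(f \<longlongrightarrow> c) net" "\<And>j. 1 \<le> j \<Longrightarrow> j \<le> - n \<Longrightarrow> c \<noteq> of_int j"
  shows "((\<lambda>x. poch_int (f x) n) \<longlongrightarrow> poch_int c n) net"
proof (cases "0 \<le> n")
  case True
  then show ?thesis
    using assms by (simp add: poch_int_def pochhammer_prod) (intro tendsto_intros)
next
  case False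
  then have "((\<lambda>x. 1 / (\<Prod>j=1..nat (- n). (f x - of_nat j))) \<longlongrightarrow> 1 / (\<Prod>j=1..nat (- n). (c - of_nat j))) net"
    using assms poch_int_denominator_nonzero[of n c] by (intro tendsto_intros) auto
  then show ?thesis using False by (simp add: poch_int_def)
qed

lemma continuous_on_poch_int:
  assumes "continuous_on A f"
    and "\<And>w j. w \<in> A \<Longrightarrow> 1 \<le> j \<Longrightarrow> j \<le> - n \<Longrightarrow> f w \<noteq> of_int j"
  shows "continuous_on A (\<lambda>w. poch_int (f w) n)"
  using assms unfolding continuous_on_def by (blast intro: tendsto_poch_int)

text \<open>There are |n| linear factors, in the numerator or the denominator, and each of them
  divided by \<open>w\<close> tends to \<open>s\<close>.\<close>

lemma poch_int_asymp:
  assumes "s \<noteq> 0"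
  shows "((\<lambda>w. poch_int (c + s * w) n / w powi n) \<longlongrightarrow> s powi n) at_infinity"
proof -
  have l: "((\<lambda>w. (d + s * w) / w) \<longlongrightarrow> s) at_infinity" for d
  proof -
    have "((\<lambda>w. d * inverse w + s) \<longlongrightarrow> d * 0 + s) at_infinity"
      by (intro tendsto_intros tendsto_inverse_0)
    moreover have "\<forall>\<^sub>F w in at_infinity. d * inverse w + s = (d + s * w) / w"
      using eventually_not_equal_at_infinity[of 0] by eventually_elim (simp add: field_simps)
    ultimately show ?thesis by (simp add: tendsto_cong)
  qed
  show ?thesis
  proof (cases "0 \<le> n")
    case True
    have "((\<lambda>w. \<Prod>i<nat n. (c + of_nat i + s * w) / w) \<longlongrightarrow> (\<Prod>i<nat n. s)) at_infinity"
      by (intro tendsto_prod l)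
    then show ?thesis using True
      by (simp add: poch_int_def pochhammer_prod prod_dividef power_int_def atLeast0LessThan add_ac)
  next
    case False
    have "((\<lambda>w. \<Prod>i=1..nat (-n). inverse ((c - of_nat i + s * w) / w)) \<longlongrightarrow> (\<Prod>i=1..nat (-n). inverse s)) at_infinity"
      using assms by (intro tendsto_prod tendsto_inverse l)
    moreover have "(\<Prod>i=1..nat (-n). inverse ((c - of_nat i + s * w) / w)) = poch_int (c + s * w) n / w powi n" for w
    proof -
      have "(\<Prod>i=1..nat (-n). inverse ((c - of_nat i + s * w) / w)) =
          (\<Prod>i=1..nat (-n). w / (c + s * w - of_nat i))"
        by (intro prod.cong) (auto simp: algebra_simps)
      then show ?thesis using False
        by (simp add: poch_int_def prod_dividef power_int_def divide_simps)
    qed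
    moreover have "(\<Prod>i=1..nat (-n). inverse s) = s powi n"
      using False by (simp add: power_int_def power_inverse)
    ultimately show ?thesis by simp
  qed
qed

section \<open>Products of Pochhammer symbols in the variable w = y - N: poles and decay\<close>

text \<open>The arguments depend on \<alpha> and \<open>w\<close> only; N enters through the indices
  \<open>p\<close> and \<open>q\<close> alone. Hence integrands for different N are products with
  the same arguments and can be compared.\<close>

definition W :: "(nat \<Rightarrow> complex) \<Rightarrow> (nat \<Rightarrow> int) \<Rightarrow> (nat \<Rightarrow> int) \<Rightarrow> complex \<Rightarrow> complex" where
  "W \<alpha> p q w = (\<Prod>k=1..6. poch_int (1 + \<alpha> k + w / 2) (p k) * poch_int (1 + \<alpha> k - w / 2) (q k))"

text \<open>The second factors of \<open>W\<close> arise from the first by changing the sign of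
  \<open>w\<close>, so the minus poles are the negatives of
  \<open>wpoles \<alpha> q\<close>.\<close>

definition wpoles :: "(nat \<Rightarrow> complex) \<Rightarrow> (nat \<Rightarrow> int) \<Rightarrow> complex set" where
  "wpoles \<alpha> p = {w. \<exists>k\<in>{1..6}. \<exists>j::int. 1 \<le> j \<and> j \<le> - p k \<and> 1 + \<alpha> k + w / 2 = of_int j}"

lemma wpoles_altdef:
  "wpoles \<alpha> p = (\<Union>k\<in>{1..6}. (\<lambda>j. 2 * (of_int j - 1 - \<alpha> k)) ` {1..- p k})"
  by (auto simp: wpoles_def image_iff field_simps Bex_def)

lemma finite_wpoles: "finite (wpoles \<alpha> p)"
  by (simp add: wpoles_altdef)

lemma wpoles_empty:
  assumes "\<And>k. k \<in> {1..6} \<Longrightarrow> 0 \<le> p k"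
  shows "wpoles \<alpha> p = {}"
  using assms by (force simp: wpoles_def)

lemma holomorphic_on_W: "W \<alpha> p q holomorphic_on - (wpoles \<alpha> p \<union> uminus ` wpoles \<alpha> q)"
proof -
  have "1 + \<alpha> k - w / 2 \<noteq> of_int j"
    if "w \<notin> uminus ` wpoles \<alpha> q" "k \<in> {1..6}" "1 \<le> j" "j \<le> - q k" for w k j
  proof -
    have "- w \<notin> wpoles \<alpha> q" using that(1) by (metis imageI minus_minus)
    then show ?thesis using that by (auto simp: wpoles_def)
  qed
  then show ?thesis
    unfolding W_def
    by (intro holomorphic_on_prod holomorphic_on_mult holomorphic_on_poch_int holomorphic_intros)
       (auto simp: wpoles_def)
qed

text \<open>Multiplying the asymptotics of the twelve factors shows that \<open>W\<close> grows at
  most like \<open>w\<close> to the sum of all indices.\<close>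

lemma W_asymp:
  assumes "D = (\<Sum>k=1..6. p k + q k)"
  obtains l where "((\<lambda>w. W \<alpha> p q w / w powi D) \<longlongrightarrow> l) at_infinity"
proof -
  let ?r = "\<lambda>k w. (poch_int (1 + \<alpha> k + (1/2) * w) (p k) / w powi (p k)) *
      (poch_int (1 + \<alpha> k + (- (1/2)) * w) (q k) / w powi (q k))"
  have lim: "((\<lambda>w. \<Prod>k=1..6. ?r k w) \<longlongrightarrow> (\<Prod>k=1..6. (1/2) powi (p k) * (- (1/2)) powi (q k))) at_infinity"
    by (intro tendsto_prod tendsto_mult poch_int_asymp) auto
  have "\<forall>\<^sub>F w in at_infinity. (\<Prod>k=1..6. ?r k w) = W \<alpha> p q w / w powi D"
    using eventually_not_equal_at_infinity[of 0]
  proof eventually_elim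
    case (elim w)
    have "w powi D = (\<Prod>k=1..6. w powi (p k + q k))"
    proof -
      have "w powi (\<Sum>k\<in>A. h k) = (\<Prod>k\<in>A. w powi (h k))" if "finite A" for A :: "nat set" and h
        using that elim by (induction A rule: finite_induct) (auto simp: power_int_add)
      then show ?thesis using assms by simp
    qed
    then show ?case
      using elim by (simp add: W_def power_int_add prod.distrib prod_dividef mult_ac)
  qed
  then show ?thesis
    using lim that by (simp add: tendsto_cong)
qed

lemma W_decay:
  assumes "(\<Sum>k=1..6. p k + q k) + int n < 0"
  shows "((\<lambda>w. w ^ n * W \<alpha> p q w) \<longlongrightarrow> 0) at_infinity"
proof -
  define D where "D = (\<Sum>k=1..6. p k + q k)"
  obtain l where l: "((\<lambda>w. W \<alpha> p q w / w powi D) \<longlongrightarrow> l) at_infinity"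
    using W_asymp[OF D_def] by blast
  define m where "m = nat (- (D + int n))"
  have m: "m > 0" "D = - int n - int m" using assms by (auto simp: m_def D_def)
  have "((\<lambda>w. (W \<alpha> p q w / w powi D) * inverse w ^ m) \<longlongrightarrow> l * 0 ^ m) at_infinity"
    by (intro tendsto_mult tendsto_power tendsto_inverse_0 l)
  moreover have "\<forall>\<^sub>F w in at_infinity. (W \<alpha> p q w / w powi D) * inverse w ^ m = w ^ n * W \<alpha> p q w"
    using eventually_not_equal_at_infinity[of 0]
  proof eventually_elim
    case (elim w)
    have "w powi D = inverse (w ^ n) * inverse (w ^ m)"
      unfolding m(2) using elim by (simp add: power_int_diff power_int_minus divide_inverse)
    then show ?case
      using elim by (simp add: power_inverse divide_inverse)
  qed
  ultimately have "((\<lambda>w. w ^ n * W \<alpha> p q w) \<longlongrightarrow> l * 0 ^ m) at_infinity"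
    by (rule Lim_transform_eventually)
  then show ?thesis using m(1) by (simp add: zero_power)
qed

section \<open>Evaluation for generic parameters\<close>

text \<open>If the value at \<open>p\<close> is not an integer, closedness of the integers suffices.
  Otherwise points with integer values are at least 1/|s| apart, so a punctured disc of that radius
  avoids them.\<close>

lemma eventually_linear_notin_Ints:
  assumes "s \<noteq> 0"
  shows "\<forall>\<^sub>F w in at p. c + s * w \<notin> (\<int> :: complex set)"
proof (cases "c + s * p \<in> \<int>")
  case False
  have "((\<lambda>w. c + s * w) \<longlongrightarrow> c + s * p) (at p)"
    by (intro tendsto_intros)
  moreover have "open (- (\<int> :: complex set))" by (simp add: open_Compl)
  ultimately have "\<forall>\<^sub>F w in at p. c + s * w \<in> - \<int>"
    using False by (intro topological_tendstoD) auto
  then show ?thesis by simp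
next
  case True
  have "\<forall>\<^sub>F w in at p. w \<in> ball p (1 / norm s) \<and> w \<noteq> p"
    using assms by (auto simp: eventually_at dist_commute intro!: exI[of _ "1 / norm s"])
  then show ?thesis
  proof eventually_elim
    case (elim w)
    show ?case
    proof
      assume "c + s * w \<in> \<int>"
      then have "(c + s * w) - (c + s * p) \<in> \<int>" using True by (rule Ints_diff)
      then obtain i where "(c + s * w) - (c + s * p) = of_int i" by (auto elim: Ints_cases)
      then have i: "s * (w - p) = of_int i" by (simp add: algebra_simps)
      have "norm (w - p) < 1 / norm s" using elim by (simp add: dist_norm norm_minus_commute)
      then have "norm s * norm (w - p) < 1" using assms by (simp add: field_simps)
      then have "norm (s * (w - p)) < 1" by (simp add: norm_mult)
      then have "\<bar>real_of_int i\<bar> < 1" unfolding i by simp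
      then have "i = 0" by linarith
      then show False using i elim assms by simp
    qed
  qed
qed

lemma eventually_not_Ints: "\<forall>\<^sub>F w in at p. c + w / 2 \<notin> (\<int> :: complex set)"
  using eventually_linear_notin_Ints[of "1 / 2" c p] by simp

text \<open>With N = n + \<nu>, e = 2 \<nu> and N_k = m k + \<nu> this is F_N at y = w + N: the
  polynomial is y^2 - N^2 = w (w + 2 N), and the indices are N_k - 1 + N and N_k - 1 - N. The
  condition on the N_k becomes \<open>2 - 3 * e\<close> for the sum of the
  \<open>m k\<close>.\<close>

definition integrand :: "(nat \<Rightarrow> complex) \<Rightarrow> int \<Rightarrow> (nat \<Rightarrow> int) \<Rightarrow> int \<Rightarrow> complex \<Rightarrow> complex" where
  "integrand \<alpha> e m n w =
    (w * (w + of_int (2 * n + e))) * W \<alpha> (\<lambda>k. m k + n + e - 1) (\<lambda>k. m k - n - 1) w"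

definition pair_product :: "(nat \<Rightarrow> complex) \<Rightarrow> int \<Rightarrow> (nat \<Rightarrow> int) \<Rightarrow> complex" where
  "pair_product \<alpha> e m = (\<Prod>(j,k)\<in>{(j,k). 1 \<le> j \<and> j < k \<and> k \<le> (6::nat)}.
    poch_int (1 + \<alpha> j + \<alpha> k) (m j + m k + e - 1))"

lemma integrand_decay:
  assumes "(\<Sum>k=1..6. m k) = 2 - 3 * e" "i \<le> 2"
  shows "((\<lambda>w. w ^ i * integrand \<alpha> e m n w) \<longlongrightarrow> 0) at_infinity"
proof -
  let ?p = "\<lambda>k. m k + n + e - 1" and ?q = "\<lambda>k. m k - n - 1"
  have "(\<Sum>k=1..6. ?p k + ?q k) = 2 * (\<Sum>k=1..6. m k) + 6 * e - 12"
    by (simp add: eval_nat_numeral algebra_simps)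
  \<comment> \<open>With the quadratic polynomial the integrand has order at most -6 at infinity,
    independently of \<open>n\<close>.\<close>
  then have D: "(\<Sum>k=1..6. ?p k + ?q k) = - 8" using assms by simp
  have d: "((\<lambda>w. w ^ j * W \<alpha> ?p ?q w) \<longlongrightarrow> 0) at_infinity" if "j < 8" for j
  proof (rule W_decay)
    show "(\<Sum>k=1..6. ?p k + ?q k) + int j < 0" unfolding D using that by simp
  qed
  have "((\<lambda>w. w ^ (i + 2) * W \<alpha> ?p ?q w + of_int (2 * n + e) * (w ^ (i + 1) * W \<alpha> ?p ?q w)) \<longlongrightarrow>
      0 + of_int (2 * n + e) * 0) at_infinity"
    using assms(2) by (intro tendsto_intros d) auto
  then show ?thesis
    by (simp add: integrand_def algebra_simps power2_eq_square)
qed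

text \<open>Only the cubic coefficient has to be explicit, since the telescoping identity uses just
  the sum of the four numbers; the others cancel there whatever they are.\<close>

lemma quartic_expansion:
  fixes c :: "'b \<Rightarrow> 'a :: comm_ring_1"
  assumes "card J = 4"
  obtains d e f where "\<And>t. (\<Prod>l\<in>J. t + c l) = t^4 + sum c J * t^3 + d * t^2 + e * t + f"
proof -
  obtain l1 l2 l3 l4 where J: "J = {l1, l2, l3, l4}" "distinct [l1, l2, l3, l4]"
    using assms by (auto simp: card_Suc_eq eval_nat_numeral)
  let ?c = "\<lambda>l. c l"
  have "(\<Prod>l\<in>J. t + c l) = t^4 + sum c J * t^3 +
      (c l1 * c l2 + c l1 * c l3 + c l1 * c l4 + c l2 * c l3 + c l2 * c l4 + c l3 * c l4) * t^2 +
      (c l1 * c l2 * c l3 + c l1 * c l2 * c l4 + c l1 * c l3 * c l4 + c l2 * c l3 * c l4) * t +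
      c l1 * c l2 * c l3 * c l4" for t
    using J(2) unfolding J(1) by (simp add: algebra_simps eval_nat_numeral)
  then show ?thesis using that by blast
qed

text \<open>As the sum of \<open>b\<close> is zero, the odd part of the first product in
  \<open>x\<close> has no term of degree 5. Divided by \<open>x\<close> it is linear in x^2, and the
  right-hand side is its interpolation at b_i^2 and b_j^2. The proof expands the product over the
  other four indices at \<open>b i\<close>, \<open>b j\<close>, \<open>x\<close> and
  \<open>- x\<close> and compares.\<close>

lemma telescoping_identity:
  fixes b :: "'b \<Rightarrow> 'a :: comm_ring_1"
  assumes I: "finite I" "card I = 6" "i \<in> I" "j \<in> I" "i \<noteq> j" and sum: "sum b I = 0"
  shows "(b i - b j) * ((\<Prod>l\<in>I. b l + x) - (\<Prod>l\<in>I. b l - x)) =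
    2 * x * ((\<Prod>l\<in>I - {i, j}. b j + b l) * ((b i + x) * (b i - x)) -
             (\<Prod>l\<in>I - {i, j}. b i + b l) * ((b j + x) * (b j - x)))"
proof -
  let ?J = "I - {i, j}"
  have "card ?J = 4" using I by (simp add: card_Diff_subset)
  then obtain d e f where J: "\<And>t. (\<Prod>l\<in>?J. t + b l) = t^4 + sum b ?J * t^3 + d * t^2 + e * t + f"
    using quartic_expansion[of ?J b] by metis
  have split: "prod h I = h i * h j * prod h ?J" for h :: "'b \<Rightarrow> 'a"
  proof -
    have "I = insert i (insert j ?J)" using I by auto
    then have "prod h I = prod h (insert i (insert j ?J))" by simp
    also have "\<dots> = h i * h j * prod h ?J"
      using I by (simp add: mult.assoc)
    finally show ?thesis .
  qed
  have "sum b I = b i + (b j + sum b ?J)"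
  proof -
    have "I = insert i (insert j ?J)" using I by auto
    then have "sum b I = sum b (insert i (insert j ?J))" by simp
    then show ?thesis using I by simp
  qed
  then have s: "sum b ?J = - (b i + b j)" using sum by (simp add: add_eq_0_iff add.assoc[symmetric])
  have m: "(\<Prod>l\<in>?J. b l - x) = (\<Prod>l\<in>?J. - x + b l)" by simp
  have p: "(\<Prod>l\<in>?J. b l + x) = (\<Prod>l\<in>?J. x + b l)" by (simp add: add.commute)
  show ?thesis
    unfolding split m p J s by (simp add: algebra_simps eval_nat_numeral)
qed

lemma infsum_linear:
  fixes f g :: "'b \<Rightarrow> complex"
  assumes "f summable_on A" "g summable_on A"
  shows "(\<Sum>\<^sub>\<infinity>n\<in>A. c * f n + d * g n) = c * infsum f A + d * infsum g A"
  using assms by (simp add: infsum_add summable_on_cmult_right infsum_cmult_right')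

text \<open>Outside this range all plus-sign or all minus-sign indices are nonnegative, for
  \<open>e = 0\<close> as for \<open>e = 1\<close>. One kind of pole is then absent and the term
  vanishes.\<close>

lemma large_index:
  fixes m :: "nat \<Rightarrow> int"
  defines "B \<equiv> (\<Sum>k=1..6. \<bar>m k\<bar>)"
  assumes "n \<notin> {- B - 1..B + 1}"
  shows "(\<forall>k\<in>{1..6}. 1 \<le> m k + n) \<or> (\<forall>k\<in>{1..6}. 1 \<le> m k - n)"
proof -
  have m: "\<bar>m k\<bar> \<le> B" if "k \<in> {1..6}" for k
    using that unfolding B_def by (rule member_le_sum) auto
  consider "n > B + 1" | "n < - B - 1" using assms(2) by fastforce
  then show ?thesis
  proof cases
    case 1
    then have "1 \<le> m k + n" if "k \<in> {1..6}" for k using m[OF that] by linarith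
    then show ?thesis by blast
  next
    case 2
    then have "1 \<le> m k - n" if "k \<in> {1..6}" for k using m[OF that] by linarith
    then show ?thesis by blast
  qed
qed

text \<open>The condition on sums includes \<open>j = k\<close> and keeps plus poles away from minus
  poles; the one on differences keeps the poles of different factors of the same kind apart. The sum
  - 1 reflects that the a_k sum to 0 and the N_k to 2.\<close>

locale generic_parameters =
  fixes \<alpha> :: "nat \<Rightarrow> complex" and e :: int
  assumes e: "e = 0 \<or> e = 1"
    and sum_\<alpha>: "(\<Sum>k=1..6. \<alpha> k) = - 1"
    and add_notin_Ints: "\<And>j k. j \<in> {1..6} \<Longrightarrow> k \<in> {1..6} \<Longrightarrow> \<alpha> j + \<alpha> k \<notin> \<int>"
    and diff_notin_Ints: "\<And>j k. j \<in> {1..6} \<Longrightarrow> k \<in> {1..6} \<Longrightarrow> j \<noteq> k \<Longrightarrow> \<alpha> j - \<alpha> k \<notin> \<int>"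
begin

section \<open>The residue sum over the plus poles as a linear functional\<close>

text \<open>These classes contain the plus poles for all indices at once, so that integrands with
  different \<open>m\<close> and \<open>n\<close> are summed over one fixed set.\<close>

definition Pinf :: "complex set" where "Pinf = {w. \<exists>k\<in>{1..6}. \<alpha> k + w / 2 \<in> \<int>}"

definition Minf :: "complex set" where "Minf = {w. \<exists>k\<in>{1..6}. \<alpha> k - w / 2 \<in> \<int>}"

lemma Pinf_Minf_disjoint: "Pinf \<inter> Minf = {}"
proof -
  have False if "j \<in> {1..6}" "k \<in> {1..6}" "\<alpha> j + w / 2 \<in> \<int>" "\<alpha> k - w / 2 \<in> \<int>" for j k w
    using add_notin_Ints[OF that(1,2)] Ints_add[OF that(3,4)] by simp
  then show ?thesis unfolding Pinf_def Minf_def by blast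
qed

lemma eventually_notin_Pinf_Minf: "\<forall>\<^sub>F w in at p. w \<notin> Pinf \<union> Minf"
proof -
  have 1: "\<forall>\<^sub>F w in at p. \<forall>k\<in>{1..6}. \<alpha> k + w / 2 \<notin> \<int>"
    by (intro eventually_ball_finite) (auto intro: eventually_not_Ints)
  have *: "\<alpha> k - w / 2 \<in> \<int> \<longleftrightarrow> - \<alpha> k + w / 2 \<in> \<int>" for k w
    using minus_in_Ints_iff[of "\<alpha> k - w / 2"] by simp
  have 2: "\<forall>\<^sub>F w in at p. \<forall>k\<in>{1..6}. \<alpha> k - w / 2 \<notin> \<int>"
    unfolding * by (intro eventually_ball_finite ballI eventually_not_Ints) simp
  show ?thesis using 1 2 by eventually_elim (auto simp: Pinf_def Minf_def)
qed

lemma wpoles_subset: "wpoles \<alpha> p \<subseteq> Pinf" "uminus ` wpoles \<alpha> p \<subseteq> Minf"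
proof -
  have "\<alpha> k + w / 2 \<in> \<int>" if "1 + \<alpha> k + w / 2 = of_int j" for k w j
  proof -
    have "\<alpha> k + w / 2 = of_int (j - 1)" using that by (simp add: algebra_simps)
    then show ?thesis by (metis Ints_of_int)
  qed
  then show "wpoles \<alpha> p \<subseteq> Pinf" "uminus ` wpoles \<alpha> p \<subseteq> Minf"
    unfolding wpoles_def Pinf_def Minf_def by fastforce+
qed

text \<open>For functions with \<open>finite_poles\<close> only finitely many terms are nonzero, so
  the infinite sum is a finite one over any finite set holding the poles in
  \<open>Pinf\<close>.\<close>

definition res_sum :: "(complex \<Rightarrow> complex) \<Rightarrow> complex" where
  "res_sum f = (\<Sum>\<^sub>\<infinity>p\<in>Pinf. residue f p)"

definition finite_poles :: "(complex \<Rightarrow> complex) \<Rightarrow> bool" where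
  "finite_poles f \<longleftrightarrow> (\<exists>P M. finite P \<and> finite M \<and> P \<subseteq> Pinf \<and> M \<subseteq> Minf \<and> f holomorphic_on - (P \<union> M))"

lemma res_sum_eq:
  assumes "finite P" "finite M" "P \<subseteq> Pinf" "M \<subseteq> Minf" "f holomorphic_on - (P \<union> M)"
  shows "res_sum f = (\<Sum>p\<in>P. residue f p)"
proof -
  have "residue f p = 0" if "p \<in> Pinf - P" for p
  proof (rule residue_holo[of "- (P \<union> M)"])
    show "open (- (P \<union> M))" using assms(1,2) by (intro open_Compl finite_imp_closed) auto
    show "p \<in> - (P \<union> M)" using that assms(4) Pinf_Minf_disjoint by auto
  qed (use assms in auto)
  then have "(residue f has_sum (\<Sum>p\<in>P. residue f p)) Pinf"
    using assms by (intro has_sum_finite_neutralI) auto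
  then show ?thesis unfolding res_sum_def by (rule infsumI)
qed

lemma res_sum_linear:
  assumes "finite_poles f" "finite_poles g"
  shows "res_sum (\<lambda>w. a * f w + b * g w) = a * res_sum f + b * res_sum g"
proof -
  obtain P M where f: "finite P" "finite M" "P \<subseteq> Pinf" "M \<subseteq> Minf" "f holomorphic_on - (P \<union> M)"
    using assms by (auto simp: finite_poles_def)
  obtain P' M' where g: "finite P'" "finite M'" "P' \<subseteq> Pinf" "M' \<subseteq> Minf" "g holomorphic_on - (P' \<union> M')"
    using assms by (auto simp: finite_poles_def)
  let ?P = "P \<union> P'" and ?M = "M \<union> M'"
  have h: "f holomorphic_on - (?P \<union> ?M)" "g holomorphic_on - (?P \<union> ?M)"
    using f(5) g(5) by (auto elim!: holomorphic_on_subset)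
  have "residue (\<lambda>w. a * f w + b * g w) p = a * residue f p + b * residue g p" for p
  proof -
    \<comment> \<open>Leaving \<open>p\<close> out of the exceptional set makes \<open>?s\<close> an
      open neighbourhood of \<open>p\<close>, whether or not \<open>p\<close> is a pole.\<close>
    let ?s = "- ((?P \<union> ?M) - {p})"
    have s: "open ?s"
      by (intro open_Compl finite_imp_closed finite_Diff) (use f g in auto)
    have p: "p \<in> ?s" by simp
    have fg: "f holomorphic_on ?s - {p}" "g holomorphic_on ?s - {p}"
      using h by (auto elim!: holomorphic_on_subset)
    then show ?thesis
      using s p by (simp add: residue_add[of ?s] residue_lmul[of ?s] holomorphic_on_mult)
  qed
  moreover have "(\<lambda>w. a * f w + b * g w) holomorphic_on - (?P \<union> ?M)"
    using h by (intro holomorphic_intros)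
  ultimately show ?thesis
    using f g h by (simp add: res_sum_eq[of ?P ?M] sum.distrib sum_distrib_left)
qed

text \<open>A residue only sees a punctured neighbourhood, which can be chosen to avoid
  \<open>Pinf\<close> and \<open>Minf\<close>. Identities derived from Pochhammer recurrences,
  available only off these sets, can therefore be used.\<close>

lemma res_sum_cong:
  assumes "\<And>w. w \<notin> Pinf \<union> Minf \<Longrightarrow> f w = g w"
  shows "res_sum f = res_sum g"
  unfolding res_sum_def
proof (rule infsum_cong)
  fix p
  have "\<forall>\<^sub>F w in at p. f w = g w"
    using eventually_notin_Pinf_Minf[of p] by eventually_elim (rule assms)
  then show "residue f p = residue g p" by (rule residue_cong) simp
qed

lemma holomorphic_times_W:
  assumes "r holomorphic_on UNIV"
  shows "(\<lambda>w. r w * W \<alpha> p q w) holomorphic_on - (wpoles \<alpha> p \<union> uminus ` wpoles \<alpha> q)"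
  using assms by (intro holomorphic_on_mult holomorphic_on_W) (auto elim: holomorphic_on_subset)

lemma finite_poles_times_W:
  assumes "r holomorphic_on UNIV"
  shows "finite_poles (\<lambda>w. r w * W \<alpha> p q w)"
  unfolding finite_poles_def
  by (rule exI[of _ "wpoles \<alpha> p"], rule exI[of _ "uminus ` wpoles \<alpha> q"],
      intro conjI holomorphic_times_W assms wpoles_subset finite_wpoles finite_imageI)

lemma res_sum_times_W:
  assumes "r holomorphic_on UNIV"
  shows "res_sum (\<lambda>w. r w * W \<alpha> p q w) = (\<Sum>x\<in>wpoles \<alpha> p. residue (\<lambda>w. r w * W \<alpha> p q w) x)"
  by (rule res_sum_eq[OF finite_wpoles finite_imageI[OF finite_wpoles] wpoles_subset
        holomorphic_times_W[OF assms]])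

text \<open>This is closing the contour below: by the decay the residues at all poles
  cancel.\<close>

lemma res_sum_times_W_minus:
  assumes r: "r holomorphic_on UNIV" and lim: "((\<lambda>w. w * (r w * W \<alpha> p q w)) \<longlongrightarrow> 0) at_infinity"
  shows "res_sum (\<lambda>w. r w * W \<alpha> p q w) =
    - (\<Sum>x\<in>uminus ` wpoles \<alpha> q. residue (\<lambda>w. r w * W \<alpha> p q w) x)"
proof -
  let ?P = "wpoles \<alpha> p" and ?M = "uminus ` wpoles \<alpha> q"
  have "(\<Sum>x\<in>?P \<union> ?M. residue (\<lambda>w. r w * W \<alpha> p q w) x) = 0"
    using holomorphic_times_W[OF r] finite_wpoles lim by (intro sum_residues_eq_0) auto
  moreover have "?P \<inter> ?M = {}"
    using wpoles_subset Pinf_Minf_disjoint by blast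
  ultimately show ?thesis
    unfolding res_sum_times_W[OF r] using finite_wpoles
    by (simp add: sum.union_disjoint eq_neg_iff_add_eq_0)
qed

lemma res_sum_times_W_zero:
  assumes r: "r holomorphic_on UNIV" and lim: "((\<lambda>w. w * (r w * W \<alpha> p q w)) \<longlongrightarrow> 0) at_infinity"
    and "(\<forall>k\<in>{1..6}. 0 \<le> p k) \<or> (\<forall>k\<in>{1..6}. 0 \<le> q k)"
  shows "res_sum (\<lambda>w. r w * W \<alpha> p q w) = 0"
  using assms(3)
proof
  assume "\<forall>k\<in>{1..6}. 0 \<le> p k"
  then have "wpoles \<alpha> p = {}" by (intro wpoles_empty) blast
  then show ?thesis by (simp add: res_sum_times_W[OF r])
next
  assume "\<forall>k\<in>{1..6}. 0 \<le> q k"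
  then have "wpoles \<alpha> q = {}" by (intro wpoles_empty) blast
  then show ?thesis by (simp add: res_sum_times_W_minus[OF r lim])
qed

abbreviation "Phi \<equiv> integrand \<alpha> e"

text \<open>The telescoping quantity, with indices halfway between the integrands for
  \<open>n - 1\<close> and \<open>n\<close>: its plus-sign indices are those for \<open>n\<close>,
  its minus-sign indices those for \<open>n - 1\<close>.\<close>

definition G :: "(nat \<Rightarrow> int) \<Rightarrow> int \<Rightarrow> complex \<Rightarrow> complex" where
  "G m n w = w * W \<alpha> (\<lambda>k. m k + n + e - 1) (\<lambda>k. m k - n) w"

lemma finite_poles_Phi: "finite_poles (Phi m n)" and finite_poles_G: "finite_poles (G m n)"
  unfolding integrand_def G_def by (auto intro!: finite_poles_times_W holomorphic_intros)

lemma Phi_decay: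
  assumes "(\<Sum>k=1..6. m k) = 2 - 3 * e"
  shows "((\<lambda>w. w * Phi m n w) \<longlongrightarrow> 0) at_infinity"
  using integrand_decay[OF assms, of 1] by simp

lemma G_decay:
  assumes "(\<Sum>k=1..6. m k) = 1 - 3 * e"
  shows "((\<lambda>w. w * G m n w) \<longlongrightarrow> 0) at_infinity"
proof -
  let ?p = "\<lambda>k. m k + n + e - 1" and ?q = "\<lambda>k. m k - n"
  have "(\<Sum>k=1..6. ?p k + ?q k) = 2 * (\<Sum>k=1..6. m k) + 6 * e - 6"
    by (simp add: eval_nat_numeral algebra_simps)
  then have "(\<Sum>k=1..6. ?p k + ?q k) + int 2 < 0"
    unfolding assms by simp
  then have "((\<lambda>w. w ^ 2 * W \<alpha> ?p ?q w) \<longlongrightarrow> 0) at_infinity"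
    by (rule W_decay)
  then show ?thesis
    by (simp add: G_def eval_nat_numeral algebra_simps)
qed

lemma res_sum_Phi_zero:
  assumes "(\<Sum>k=1..6. m k) = 2 - 3 * e"
    and n: "(\<forall>k\<in>{1..6}. 0 \<le> m k + n + e - 1) \<or> (\<forall>k\<in>{1..6}. 0 \<le> m k - n - 1)"
  shows "res_sum (Phi m n) = 0"
  using Phi_decay[OF assms(1), of n] n unfolding integrand_def
  by (intro res_sum_times_W_zero holomorphic_intros)

lemma res_sum_G_zero:
  assumes "(\<Sum>k=1..6. m k) = 1 - 3 * e"
    and n: "(\<forall>k\<in>{1..6}. 0 \<le> m k + n + e - 1) \<or> (\<forall>k\<in>{1..6}. 0 \<le> m k - n)"
  shows "res_sum (G m n) = 0"
  using G_decay[OF assms(1), of n] n unfolding G_def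
  by (intro res_sum_times_W_zero holomorphic_intros)

lemma summable_res_sum_Phi:
  assumes "(\<Sum>k=1..6. m k) = 2 - 3 * e"
  shows "(\<lambda>n. res_sum (Phi m n)) summable_on UNIV"
proof -
  define I where "I = {- (\<Sum>k=1..6. \<bar>m k\<bar>) - 1..(\<Sum>k=1..6. \<bar>m k\<bar>) + 1}"
  have "res_sum (Phi m n) = 0" if "n \<notin> I" for n
    using large_index[of n m] that e by (intro res_sum_Phi_zero assms) (force simp: I_def)
  then have "((\<lambda>n. res_sum (Phi m n)) has_sum (\<Sum>n\<in>I. res_sum (Phi m n))) UNIV"
    by (intro has_sum_finite_neutralI) (auto simp: I_def)
  then show ?thesis by (rule has_sum_imp_summable)
qed

lemma summable_res_sum_G:
  assumes "(\<Sum>k=1..6. m k) = 1 - 3 * e"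
  shows "(\<lambda>n. res_sum (G m n)) summable_on UNIV"
proof -
  define I where "I = {- (\<Sum>k=1..6. \<bar>m k\<bar>) - 1..(\<Sum>k=1..6. \<bar>m k\<bar>) + 1}"
  have "res_sum (G m n) = 0" if "n \<notin> I" for n
    using large_index[of n m] that e by (intro res_sum_G_zero assms) (force simp: I_def)
  then have "((\<lambda>n. res_sum (G m n)) has_sum (\<Sum>n\<in>I. res_sum (G m n))) UNIV"
    by (intro has_sum_finite_neutralI) (auto simp: I_def)
  then show ?thesis by (rule has_sum_imp_summable)
qed

section \<open>The recurrence for the sum over N\<close>

definition S :: "(nat \<Rightarrow> int) \<Rightarrow> complex" where
  "S m = (\<Sum>\<^sub>\<infinity>n. res_sum (Phi m n))"

text \<open>This is \<alpha>_k + N_k. Centring by \<open>e / 2\<close> makes the factors that raise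
  the indices equal to b_k + x and b_k - x with x = w/2 + N.\<close>

definition b :: "(nat \<Rightarrow> int) \<Rightarrow> nat \<Rightarrow> complex" where
  "b m k = \<alpha> k + of_int (m k) + of_int e / 2"

text \<open>In the notation of the overview, \<open>C j i m\<close> is A and \<open>C i j m\<close>
  is B.\<close>

abbreviation C :: "nat \<Rightarrow> nat \<Rightarrow> (nat \<Rightarrow> int) \<Rightarrow> complex" where
  "C i j m \<equiv> (\<Prod>l\<in>{1..6} - {i, j}. b m i + b m l)"

text \<open>Off \<open>Pinf\<close> and \<open>Minf\<close> the recurrence for
  \<open>poch_int\<close> applies to every factor. Singletons \<open>A\<close>, \<open>B\<close>
  serve to raise one \<open>m k\<close>; the full and the empty set serve for
  \<open>G\<close>.\<close>

lemma W_shift: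
  assumes w: "w \<notin> Pinf \<union> Minf" and AB: "A \<subseteq> {1..6}" "B \<subseteq> {1..6}"
    and p': "\<And>k. k \<in> {1..6} \<Longrightarrow> p' k = p k + (if k \<in> A then 1 else 0)"
    and q': "\<And>k. k \<in> {1..6} \<Longrightarrow> q' k = q k + (if k \<in> B then 1 else 0)"
  shows "W \<alpha> p' q' w = (\<Prod>k\<in>A. 1 + \<alpha> k + w / 2 + of_int (p k)) *
      (\<Prod>k\<in>B. 1 + \<alpha> k - w / 2 + of_int (q k)) * W \<alpha> p q w"
proof -
  let ?x = "\<lambda>k. 1 + \<alpha> k + w / 2" and ?y = "\<lambda>k. 1 + \<alpha> k - w / 2"
  have nz: "?x k + of_int (p k) \<noteq> 0" "?y k + of_int (q k) \<noteq> 0" if "k \<in> {1..6}" for k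
  proof -
    have x: "\<alpha> k + w / 2 \<notin> \<int>" and y: "\<alpha> k - w / 2 \<notin> \<int>"
      using w that by (auto simp: Pinf_def Minf_def)
    show "?x k + of_int (p k) \<noteq> 0"
    proof
      assume "?x k + of_int (p k) = 0"
      then have "\<alpha> k + w / 2 = of_int (- 1 - p k)" by (simp add: algebra_simps eq_neg_iff_add_eq_0)
      then show False using x by (metis Ints_of_int)
    qed
    show "?y k + of_int (q k) \<noteq> 0"
    proof
      assume "?y k + of_int (q k) = 0"
      then have "\<alpha> k - w / 2 = of_int (- 1 - q k)" by (simp add: algebra_simps eq_neg_iff_add_eq_0)
      then show False using y by (metis Ints_of_int)
    qed
  qed
  have "W \<alpha> p' q' w = (\<Prod>k=1..6. (if k \<in> A then ?x k + of_int (p k) else 1) *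
      (if k \<in> B then ?y k + of_int (q k) else 1) *
      (poch_int (?x k) (p k) * poch_int (?y k) (q k)))"
    unfolding W_def
  proof (rule prod.cong[OF refl])
    fix k :: nat assume k: "k \<in> {1..6}"
    show "poch_int (?x k) (p' k) * poch_int (?y k) (q' k) =
        (if k \<in> A then ?x k + of_int (p k) else 1) *
        (if k \<in> B then ?y k + of_int (q k) else 1) *
        (poch_int (?x k) (p k) * poch_int (?y k) (q k))"
      using nz[OF k] p'[OF k] q'[OF k] by (simp add: poch_int_add_1)
  qed
  moreover have "(\<Prod>k=1..6. if k \<in> D then h k else 1) = prod h D" if "D \<subseteq> {1..6}" for D and h :: "nat \<Rightarrow> complex"
    using that by (simp add: prod.If_cases Int_absorb1)
  ultimately show ?thesis using AB by (simp add: prod.distrib W_def)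
qed

text \<open>For the lowered vector the contributions are - 1, \<open>1 - 3 * e\<close> and
  \<open>3 * e\<close>; this is why the recurrence starts from a sum one below the required
  one.\<close>

lemma sum_b:
  assumes "(\<Sum>k=1..6. m k) = 1 - 3 * e"
  shows "(\<Sum>k=1..6. b m k) = 0"
proof -
  have "(\<Sum>k=1..6. b m k) = (\<Sum>k=1..6. \<alpha> k) + of_int (\<Sum>k=1..6. m k) + 3 * of_int e"
    unfolding b_def sum.distrib by simp
  then show ?thesis unfolding assms sum_\<alpha> by simp
qed

text \<open>All four functions are multiples of the common product \<open>U\<close>: the integrands
  by 2 w x (b_l^2 - x^2), and the two values of \<open>G\<close> by \<open>w\<close> times the
  product of all b_k + x, respectively b_k - x. What remains is
  \<open>telescoping_identity\<close>.\<close>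

lemma Phi_telescope:
  assumes m: "(\<Sum>k=1..6. m k) = 1 - 3 * e" and ij: "i \<in> {1..6}" "j \<in> {1..6}" "i \<noteq> j"
    and w: "w \<notin> Pinf \<union> Minf"
  shows "C j i m * Phi (m(i := m i + 1)) n w + (- C i j m) * Phi (m(j := m j + 1)) n w =
    (b m i - b m j) * G m (n + 1) w + (b m j - b m i) * G m n w"
proof -
  define U where "U = W \<alpha> (\<lambda>k. m k + n + e - 1) (\<lambda>k. m k - n - 1) w"
  define x where "x = w / 2 + of_int n + of_int e / 2"
  have bx: "1 + \<alpha> k + w / 2 + of_int (m k + n + e - 1) = b m k + x"
    "1 + \<alpha> k - w / 2 + of_int (m k - n - 1) = b m k - x" for k
    by (simp_all add: b_def x_def algebra_simps)
  have Phi: "Phi (m(l := m l + 1)) n w = w * (2 * x) * ((b m l + x) * (b m l - x)) * U"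
    if l: "l \<in> {1..6}" for l
  proof -
    have "W \<alpha> (\<lambda>k. (m(l := m l + 1)) k + n + e - 1) (\<lambda>k. (m(l := m l + 1)) k - n - 1) w =
        (\<Prod>k\<in>{l}. 1 + \<alpha> k + w / 2 + of_int (m k + n + e - 1)) *
        (\<Prod>k\<in>{l}. 1 + \<alpha> k - w / 2 + of_int (m k - n - 1)) * U"
      unfolding U_def by (rule W_shift[OF w]) (use l in auto)
    then have "W \<alpha> (\<lambda>k. (m(l := m l + 1)) k + n + e - 1) (\<lambda>k. (m(l := m l + 1)) k - n - 1) w =
        (b m l + x) * (b m l - x) * U"
      unfolding bx by simp
    moreover have "w + of_int (2 * n + e) = 2 * x" by (simp add: x_def)
    ultimately show ?thesis by (simp add: integrand_def mult.assoc)
  qed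
  have "W \<alpha> (\<lambda>k. m k + (n + 1) + e - 1) (\<lambda>k. m k - (n + 1)) w =
        (\<Prod>k\<in>{1..6}. 1 + \<alpha> k + w / 2 + of_int (m k + n + e - 1)) *
        (\<Prod>k\<in>{}. 1 + \<alpha> k - w / 2 + of_int (m k - n - 1)) * U"
    unfolding U_def by (rule W_shift[OF w]) auto
  then have G1: "G m (n + 1) w = w * ((\<Prod>k=1..6. b m k + x) * U)"
    unfolding bx G_def by simp
  have "W \<alpha> (\<lambda>k. m k + n + e - 1) (\<lambda>k. m k - n) w =
        (\<Prod>k\<in>{}. 1 + \<alpha> k + w / 2 + of_int (m k + n + e - 1)) *
        (\<Prod>k\<in>{1..6}. 1 + \<alpha> k - w / 2 + of_int (m k - n - 1)) * U"
    unfolding U_def by (rule W_shift[OF w]) auto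
  then have G0: "G m n w = w * ((\<Prod>k=1..6. b m k - x) * U)"
    unfolding bx G_def by simp
  have id: "(b m i - b m j) * ((\<Prod>k=1..6. b m k + x) - (\<Prod>k=1..6. b m k - x)) =
    2 * x * (C j i m * ((b m i + x) * (b m i - x)) - C i j m * ((b m j + x) * (b m j - x)))"
    using telescoping_identity[of "{1..6}" i j "b m" x] ij sum_b[OF m] by (simp add: insert_commute)
  have "C j i m * Phi (m(i := m i + 1)) n w + (- C i j m) * Phi (m(j := m j + 1)) n w =
      w * U * (2 * x * (C j i m * ((b m i + x) * (b m i - x)) - C i j m * ((b m j + x) * (b m j - x))))"
    unfolding Phi[OF ij(1)] Phi[OF ij(2)] by (simp add: algebra_simps)
  also have "\<dots> = (b m i - b m j) * G m (n + 1) w + (b m j - b m i) * G m n w"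
    unfolding id[symmetric] G0 G1 by (simp add: algebra_simps)
  finally show ?thesis .
qed

lemma sum_fun_upd_add_1:
  fixes m :: "nat \<Rightarrow> int"
  assumes "l \<in> {1..6}"
  shows "(\<Sum>k=1..6. (m(l := m l + 1)) k) = (\<Sum>k=1..6. m k) + 1"
proof -
  have "(\<Sum>k=1..6. (m(l := m l + 1)) k) = (\<Sum>k=1..6. m k + (if k = l then 1 else 0))"
    by (rule sum.cong) auto
  then show ?thesis using assms by (simp add: sum.distrib)
qed

text \<open>Apply \<open>res_sum\<close> to the telescoping relation and sum over \<open>n\<close>.
  The two sums over \<open>G\<close> agree after a shift of \<open>n\<close> and have opposite
  coefficients.\<close>

lemma S_shift:
  assumes m: "(\<Sum>k=1..6. m k) = 1 - 3 * e" and ij: "i \<in> {1..6}" "j \<in> {1..6}" "i \<noteq> j"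
  shows "C j i m * S (m(i := m i + 1)) = C i j m * S (m(j := m j + 1))"
proof -
  have s: "(\<lambda>n. res_sum (Phi (m(l := m l + 1)) n)) summable_on UNIV" if "l \<in> {1..6}" for l
    using sum_fun_upd_add_1[OF that, of m] m by (intro summable_res_sum_Phi) simp
  note g = summable_res_sum_G[OF m]
  have bij: "bij (\<lambda>n::int. n + 1)" by (rule bij_betwI[of _ _ _ "\<lambda>n. n - 1"]) auto
  have g': "(\<lambda>n. res_sum (G m (n + 1))) summable_on UNIV"
    using summable_on_reindex_bij_betw[OF bij, of "\<lambda>n. res_sum (G m n)"] g by simp
  have "C j i m * res_sum (Phi (m(i := m i + 1)) n) + (- C i j m) * res_sum (Phi (m(j := m j + 1)) n) =
      (b m i - b m j) * res_sum (G m (n + 1)) + (b m j - b m i) * res_sum (G m n)" for n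
  proof -
    have "res_sum (\<lambda>w. C j i m * Phi (m(i := m i + 1)) n w + (- C i j m) * Phi (m(j := m j + 1)) n w) =
        res_sum (\<lambda>w. (b m i - b m j) * G m (n + 1) w + (b m j - b m i) * G m n w)"
      by (rule res_sum_cong) (rule Phi_telescope[OF m ij])
    then show ?thesis
      unfolding res_sum_linear[OF finite_poles_Phi finite_poles_Phi] res_sum_linear[OF finite_poles_G finite_poles_G] .
  qed
  then have "(\<Sum>\<^sub>\<infinity>n. C j i m * res_sum (Phi (m(i := m i + 1)) n) + (- C i j m) * res_sum (Phi (m(j := m j + 1)) n)) =
      (\<Sum>\<^sub>\<infinity>n. (b m i - b m j) * res_sum (G m (n + 1)) + (b m j - b m i) * res_sum (G m n))"
    by simp
  moreover have "(\<Sum>\<^sub>\<infinity>n. C j i m * res_sum (Phi (m(i := m i + 1)) n) + (- C i j m) * res_sum (Phi (m(j := m j + 1)) n)) =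
      C j i m * S (m(i := m i + 1)) + (- C i j m) * S (m(j := m j + 1))"
    unfolding S_def by (rule infsum_linear[OF s s]) (rule ij)+
  moreover have "(\<Sum>\<^sub>\<infinity>n. (b m i - b m j) * res_sum (G m (n + 1)) + (b m j - b m i) * res_sum (G m n)) =
      (b m i - b m j) * (\<Sum>\<^sub>\<infinity>n. res_sum (G m (n + 1))) + (b m j - b m i) * (\<Sum>\<^sub>\<infinity>n. res_sum (G m n))"
    by (rule infsum_linear[OF g' g])
  moreover have "(\<Sum>\<^sub>\<infinity>n. res_sum (G m (n + 1))) = (\<Sum>\<^sub>\<infinity>n. res_sum (G m n))"
    by (rule infsum_reindex_bij_betw[OF bij])
  ultimately show ?thesis by (simp add: algebra_simps)
qed

abbreviation "R \<equiv> pair_product \<alpha> e"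

end

section \<open>Tools for the base cases, and the recurrence for the right-hand side\<close>

lemma residue_simple_quotient:
  assumes "finite X" "z \<notin> X" "h holomorphic_on - X" "\<And>w. f w = h w / (w - z)"
  shows "residue f z = h z"
proof -
  have "open (- X)" using assms(1) by (simp add: finite_imp_closed open_Compl)
  moreover have "f = (\<lambda>w. h w / (w - z))" using assms(4) by blast
  ultimately show ?thesis using residue_simple[of "- X" z h] assms by simp
qed

text \<open>Up to sign, the left side is the third divided difference of the square root at the
  squares of the four numbers.\<close>

lemma square_root_divided_difference:
  fixes x y z u :: complex
  assumes "x \<noteq> y" "x \<noteq> z" "x \<noteq> u" "y \<noteq> z" "y \<noteq> u" "z \<noteq> u"
    and "x + y \<noteq> 0" "x + z \<noteq> 0" "x + u \<noteq> 0" "y + z \<noteq> 0" "y + u \<noteq> 0" "z + u \<noteq> 0"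
  shows "x / (((y - x) * (y + x)) * ((z - x) * (z + x)) * ((u - x) * (u + x))) +
         y / (((x - y) * (x + y)) * ((z - y) * (z + y)) * ((u - y) * (u + y))) +
         z / (((x - z) * (x + z)) * ((y - z) * (y + z)) * ((u - z) * (u + z))) +
         u / (((x - u) * (x + u)) * ((y - u) * (y + u)) * ((z - u) * (z + u))) =
         - (x + y + z + u) / ((x + y) * (x + z) * (x + u) * (y + z) * (y + u) * (z + u))"
proof -
  define a b c d e f where "a = (y - x) * (y + x)" and "b = (z - x) * (z + x)" and
    "c = (u - x) * (u + x)" and "d = (z - y) * (z + y)" and "e = (u - y) * (u + y)" and
    "f = (u - z) * (u + z)"
  note defs = a_def b_def c_def d_def e_def f_def
  have nz: "a \<noteq> 0" "b \<noteq> 0" "c \<noteq> 0" "d \<noteq> 0" "e \<noteq> 0" "f \<noteq> 0"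
    using assms by (auto simp: defs add.commute)
  define V where "V = (y - x) * (z - x) * (u - x) * (z - y) * (u - y) * (u - z)"
  define T where "T = (x + y) * (x + z) * (x + u) * (y + z) * (y + u) * (z + u)"
  have VT: "V \<noteq> 0" "T \<noteq> 0" using assms by (auto simp: V_def T_def)
  have P: "a * b * c * d * e * f = V * T" by (simp add: defs V_def T_def mult_ac add_ac)
  have neg: "(x - y) * (x + y) = - a" "(x - z) * (x + z) = - b" "(x - u) * (x + u) = - c"
    "(y - z) * (y + z) = - d" "(y - u) * (y + u) = - e" "(z - u) * (z + u) = - f"
    by (simp_all add: defs algebra_simps)
  have "x / (a * b * c) + y / (- a * d * e) + z / (- b * - d * f) + u / (- c * - e * - f) =
      (x * (d * e * f) - y * (b * c * f) + z * (a * c * e) - u * (a * b * d)) / (a * b * c * d * e * f)"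
    using nz by (simp add: field_simps)
  \<comment> \<open>The numerator is alternating, hence a multiple of the Vandermonde product
    \<open>V\<close>, which then cancels against the common denominator
    \<open>V * T\<close>.\<close>
  also have "x * (d * e * f) - y * (b * c * f) + z * (a * c * e) - u * (a * b * d) = - (x + y + z + u) * V"
    unfolding defs V_def by algebra
  also have "- (x + y + z + u) * V / (a * b * c * d * e * f) = - (x + y + z + u) / T"
    unfolding P using VT by simp
  finally show ?thesis
    unfolding neg a_def[symmetric] b_def[symmetric] c_def[symmetric] d_def[symmetric] e_def[symmetric]
      f_def[symmetric] T_def by simp
qed

lemma atLeastAtMost_1_6: "{1..6::nat} = {1, 2, 3, 4, 5, 6}"
  by auto

lemma pairs_1_6: "{(j,k). 1 \<le> j \<and> j < k \<and> k \<le> (6::nat)} =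
  {(1,2), (1,3), (1,4), (1,5), (1,6), (2,3), (2,4), (2,5), (2,6), (3,4), (3,5), (3,6), (4,5), (4,6), (5,6)}"
  (is "?L = ?R")
proof (rule equalityI)
  show "?L \<subseteq> ?R"
  proof (rule subrelI)
    fix j k assume "(j, k) \<in> ?L"
    then have jk: "1 \<le> j" "j < k" "k \<le> 6" by simp_all
    then have "j \<in> {1, 2, 3, 4, 5, 6}" "k \<in> {1, 2, 3, 4, 5, 6}"
      unfolding atLeastAtMost_1_6[symmetric] by simp_all
    then show "(j, k) \<in> ?R"
      using jk(2) by (elim insertE emptyE; simp)
  qed
  show "?R \<subseteq> ?L" by simp
qed

lemma prod_pairs_containing:
  fixes h :: "nat \<Rightarrow> nat \<Rightarrow> complex"
  assumes "i \<in> {1..6}" "\<And>j k. h j k = h k j"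
  shows "(\<Prod>(j,k)\<in>{(j,k). 1 \<le> j \<and> j < k \<and> k \<le> (6::nat)}. if i = j \<or> i = k then h j k else 1) =
    (\<Prod>l\<in>{1..6} - {i}. h i l)"
proof -
  have "i \<in> {1, 2, 3, 4, 5, 6}" using assms(1) unfolding atLeastAtMost_1_6 .
  then show ?thesis
    unfolding pairs_1_6 atLeastAtMost_1_6 by (elim insertE) (simp_all add: assms(2) insert_Diff_if)
qed

text \<open>The pole is written as \<open>w - z\<close>, even with a double minus, to match
  \<open>residue_simple_quotient\<close>.\<close>

lemma half_pole: "1 / (c + w / 2) = 2 / (w - - (2 * c))" "1 / (c - w / 2) = - 2 / (w - 2 * c)" for c w :: complex
proof -
  have "2 / (w + 2 * c) = 1 / ((w + 2 * c) / 2)" by simp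
  also have "(w + 2 * c) / 2 = c + w / 2" by (simp add: field_simps)
  finally show "1 / (c + w / 2) = 2 / (w - - (2 * c))" by simp
  have "- 2 / (w - 2 * c) = 1 / (- ((w - 2 * c) / 2))" by simp
  also have "- ((w - 2 * c) / 2) = c - w / 2" by (simp add: field_simps)
  finally show "1 / (c - w / 2) = - 2 / (w - 2 * c)" by simp
qed

lemma half_eq_0_iff: "c + w / 2 = 0 \<longleftrightarrow> w = - (2 * c)" "c - w / 2 = 0 \<longleftrightarrow> w = 2 * c" for c w :: complex
proof -
  have 1: "c + w / 2 = 0 \<longleftrightarrow> 2 * (c + w / 2) = 0" "c - w / 2 = 0 \<longleftrightarrow> 2 * (c - w / 2) = 0"
    by (simp_all only: mult_eq_0_iff) simp_all
  have 2: "2 * (c + w / 2) = w - - (2 * c)" "2 * (c - w / 2) = - (w - 2 * c)" by simp_all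
  show "c + w / 2 = 0 \<longleftrightarrow> w = - (2 * c)"
    by (subst 1, subst 2, rule right_minus_eq)
  show "c - w / 2 = 0 \<longleftrightarrow> w = 2 * c"
    by (subst 1, subst 2, unfold neg_equal_0_iff_equal, rule right_minus_eq)
qed

lemma times_half_pole: "x * (1 / (c + w / 2)) = 2 * x / (w - - (2 * c))"
  "x * (1 / (c - w / 2)) = - 2 * x / (w - 2 * c)" for c w x :: complex
  unfolding half_pole by simp_all

lemma poch_int_shifted:
  "poch_int (1 + a + z) (- 1) = 1 / (a + z)" "poch_int (1 + a - z) (- 1) = 1 / (a - z)"
  "poch_int (1 + a + z) (- 2) = 1 / ((a + z) * (a - 1 + z))"
  "poch_int (1 + a - z) (- 2) = 1 / ((a - z) * (a - 1 - z))"
proof -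
  have "1 + a + z - 1 = a + z" "1 + a + z - 2 = a - 1 + z"
    "1 + a - z - 1 = a - z" "1 + a - z - 2 = a - 1 - z" by simp_all
  then show "poch_int (1 + a + z) (- 1) = 1 / (a + z)" "poch_int (1 + a - z) (- 1) = 1 / (a - z)"
    "poch_int (1 + a + z) (- 2) = 1 / ((a + z) * (a - 1 + z))"
    "poch_int (1 + a - z) (- 2) = 1 / ((a - z) * (a - 1 - z))"
    unfolding poch_int_minus_1 poch_int_minus_2 by simp_all
qed

context generic_parameters
begin

lemma add_int_nonzero:
  assumes "j \<in> {1..6}" "k \<in> {1..6}"
  shows "\<alpha> j + \<alpha> k + of_int n \<noteq> 0"
proof
  assume "\<alpha> j + \<alpha> k + of_int n = 0"
  then have "\<alpha> j + \<alpha> k = of_int (- n)" by (simp add: eq_neg_iff_add_eq_0)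
  then show False using add_notin_Ints[OF assms] by (metis Ints_of_int)
qed

lemma b_add_b: "b m j + b m k = \<alpha> j + \<alpha> k + of_int (m j + m k + e)"
  by (simp add: b_def)

lemma b_add_b_nonzero: "j \<in> {1..6} \<Longrightarrow> k \<in> {1..6} \<Longrightarrow> b m j + b m k \<noteq> 0"
  unfolding b_add_b by (rule add_int_nonzero)

text \<open>Raising \<open>m i\<close> raises the index of exactly the five pairs containing
  \<open>i\<close>, each of which gains the factor b_i + b_l.\<close>

lemma R_shift:
  assumes i: "i \<in> {1..6}"
  shows "R (m(i := m i + 1)) = (\<Prod>l\<in>{1..6} - {i}. b m i + b m l) * R m"
proof -
  let ?T = "{(j,k). 1 \<le> j \<and> j < k \<and> k \<le> (6::nat)}"
  have "R (m(i := m i + 1)) = (\<Prod>(j,k)\<in>?T. (if i = j \<or> i = k then b m j + b m k else 1) *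
      poch_int (1 + \<alpha> j + \<alpha> k) (m j + m k + e - 1))"
    unfolding pair_product_def
  proof (rule prod.cong[OF refl], clarify)
    fix j k :: nat assume jk: "1 \<le> j" "j < k" "k \<le> 6"
    let ?n = "m j + m k + e - 1"
    have s: "1 + \<alpha> j + \<alpha> k + of_int ?n = b m j + b m k" by (simp add: b_add_b)
    have "b m j + b m k \<noteq> 0" using jk by (intro b_add_b_nonzero) auto
    then have "poch_int (1 + \<alpha> j + \<alpha> k) (?n + 1) = (b m j + b m k) * poch_int (1 + \<alpha> j + \<alpha> k) ?n"
      using poch_int_add_1[of "1 + \<alpha> j + \<alpha> k" ?n] unfolding s by blast
    moreover have "(m(i := m i + 1)) j + (m(i := m i + 1)) k + e - 1 = (if i = j \<or> i = k then ?n + 1 else ?n)"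
      using jk by auto
    ultimately show "poch_int (1 + \<alpha> j + \<alpha> k) ((m(i := m i + 1)) j + (m(i := m i + 1)) k + e - 1) =
        (if i = j \<or> i = k then b m j + b m k else 1) * poch_int (1 + \<alpha> j + \<alpha> k) ?n"
      by simp
  qed
  also have "\<dots> = (\<Prod>(j,k)\<in>?T. if i = j \<or> i = k then b m j + b m k else 1) * R m"
    unfolding pair_product_def case_prod_unfold by (rule prod.distrib)
  finally show ?thesis
    using prod_pairs_containing[OF i, of "\<lambda>j k. b m j + b m k"] by (simp add: add.commute)
qed

text \<open>By \<open>R_shift\<close> the right-hand sides for \<open>i\<close> and \<open>j\<close>
  share the factor b_i + b_j and otherwise stand in the ratio of \<open>C i j m\<close> to
  \<open>C j i m\<close>, as \<open>S_shift\<close> demands. Genericity allows division by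
  \<open>C i j m\<close>. The constant 4 is 8 pi i over the 2 pi i of the residue theorem.\<close>

lemma S_eq_R_shift:
  assumes m: "(\<Sum>k=1..6. m k) = 1 - 3 * e" and ij: "i \<in> {1..6}" "j \<in> {1..6}" "i \<noteq> j"
    and S: "S (m(i := m i + 1)) = 4 * R (m(i := m i + 1))"
  shows "S (m(j := m j + 1)) = 4 * R (m(j := m j + 1))"
proof -
  have R: "R (m(k := m k + 1)) = (b m k + b m l) * C k l m * R m"
    if "k \<in> {1..6}" "l \<in> {1..6}" "k \<noteq> l" for k l
  proof -
    have "{1..6} - {k} = insert l ({1..6} - {k, l})" using that by auto
    then have "(\<Prod>l\<in>{1..6} - {k}. b m k + b m l) = (b m k + b m l) * C k l m"
      by simp
    then show ?thesis using R_shift[OF that(1), of m] by simp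
  qed
  have nz: "C i j m \<noteq> 0"
    using ij b_add_b_nonzero by auto
  have "C i j m * S (m(j := m j + 1)) = C j i m * S (m(i := m i + 1))"
    using S_shift[OF m ij] by simp
  also have "\<dots> = C i j m * (4 * R (m(j := m j + 1)))"
    unfolding S R[OF ij] R[OF ij(2,1) ij(3)[symmetric]] by (simp add: mult_ac add.commute)
  finally show ?thesis using nz by simp
qed

lemma S_cong: "(\<And>k. k \<in> {1..6} \<Longrightarrow> m k = m' k) \<Longrightarrow> S m = S m'"
proof -
  assume eq: "\<And>k. k \<in> {1..6} \<Longrightarrow> m k = m' k"
  have "Phi m n = Phi m' n" for n
    using eq by (auto simp: integrand_def W_def fun_eq_iff intro!: prod.cong)
  then show ?thesis by (simp add: S_def)
qed

lemma R_cong: "(\<And>k. k \<in> {1..6} \<Longrightarrow> m k = m' k) \<Longrightarrow> R m = R m'"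
  unfolding pair_product_def by (rule prod.cong) auto

text \<open>Both vectors have the same sum, so unless they agree on 1..6 some entry of
  \<open>m\<close> is too small and another too large. Moving one unit between the two brings
  \<open>m\<close> closer to \<open>m0\<close> in the l1 distance.\<close>

lemma S_eq_R_induct:
  assumes m0: "(\<Sum>k=1..6. m0 k) = 2 - 3 * e" "S m0 = 4 * R m0"
    and m: "(\<Sum>k=1..6. m k) = 2 - 3 * e"
  shows "S m = 4 * R m"
  using m
proof (induction "nat (\<Sum>k=1..6. \<bar>m k - m0 k\<bar>)" arbitrary: m rule: less_induct)
  case less
  have sum0: "(\<Sum>k=1..6. m k - m0 k) = 0"
    using less.prems m0(1) by (simp add: sum_subtractf)
  show ?case
  proof (cases "\<forall>k\<in>{1..6}. m k = m0 k")
    case True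
    then have "S m = S m0" "R m = R m0" using S_cong[of m m0] R_cong[of m m0] by auto
    then show ?thesis using m0 by simp
  next
    case False
    obtain i where i: "i \<in> {1..6}" "m i < m0 i"
    proof (rule ccontr)
      assume "\<not> thesis"
      then have nn: "\<And>k. k \<in> {1..6} \<Longrightarrow> 0 \<le> m k - m0 k" using that by force
      then have "\<forall>k\<in>{1..6}. m k - m0 k = 0"
        using sum_nonneg_eq_0_iff[of "{1..6}" "\<lambda>k. m k - m0 k"] sum0 by blast
      then show False using False by auto
    qed
    obtain j where j: "j \<in> {1..6}" "m0 j < m j"
    proof (rule ccontr)
      assume "\<not> thesis"
      then have nn: "\<And>k. k \<in> {1..6} \<Longrightarrow> 0 \<le> m0 k - m k" using that by force
      moreover have "(\<Sum>k=1..6. m0 k - m k) = 0" using sum0 by (simp add: sum_subtractf)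
      ultimately have "\<forall>k\<in>{1..6}. m0 k - m k = 0"
        using sum_nonneg_eq_0_iff[of "{1..6}" "\<lambda>k. m0 k - m k"] by blast
      then show False using False by auto
    qed
    have ij: "i \<noteq> j" using i j by auto
    \<comment> \<open>This is the lowered vector of the recurrence: raising entry \<open>j\<close>
      gives back \<open>m\<close>, raising entry \<open>i\<close> gives the closer vector
      \<open>m2\<close>.\<close>
    define m1 where "m1 = m(j := m j - 1)"
    define m2 where "m2 = m1(i := m1 i + 1)"
    have m_m1: "m = m1(j := m1 j + 1)" by (simp add: m1_def)
    have s1: "(\<Sum>k=1..6. m1 k) = 1 - 3 * e"
      using sum_fun_upd_add_1[OF j(1), of m1] less.prems by (simp flip: m_m1)
    have s2: "(\<Sum>k=1..6. m2 k) = 2 - 3 * e"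
      unfolding m2_def using sum_fun_upd_add_1[OF i(1), of m1] s1 by simp
    have "(\<Sum>k=1..6. \<bar>m2 k - m0 k\<bar>) < (\<Sum>k=1..6. \<bar>m k - m0 k\<bar>)"
    proof (rule sum_strict_mono_ex1)
      show "\<forall>k\<in>{1..6}. \<bar>m2 k - m0 k\<bar> \<le> \<bar>m k - m0 k\<bar>"
        using i j ij by (auto simp: m2_def m1_def)
      show "\<exists>k\<in>{1..6}. \<bar>m2 k - m0 k\<bar> < \<bar>m k - m0 k\<bar>"
        using i ij by (intro bexI[of _ i]) (auto simp: m2_def m1_def)
    qed simp
    moreover have "0 \<le> (\<Sum>k=1..6. \<bar>m2 k - m0 k\<bar>)" by (simp add: sum_nonneg)
    ultimately have "nat (\<Sum>k=1..6. \<bar>m2 k - m0 k\<bar>) < nat (\<Sum>k=1..6. \<bar>m k - m0 k\<bar>)" by linarith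
    then have "S m2 = 4 * R m2" using less.hyps s2 by blast
    then show ?thesis
      using S_eq_R_shift[OF s1 i(1) j(1) ij] unfolding m2_def m_m1[symmetric] by blast
  qed
qed

lemma S_finite:
  assumes "finite I" "(\<Sum>k=1..6. m k) = 2 - 3 * e"
    "\<And>n. n \<notin> I \<Longrightarrow> (\<forall>k\<in>{1..6}. 0 \<le> m k + n + e - 1) \<or> (\<forall>k\<in>{1..6}. 0 \<le> m k - n - 1)"
  shows "S m = (\<Sum>n\<in>I. res_sum (Phi m n))"
proof -
  have "res_sum (Phi m n) = 0" if "n \<notin> I" for n
    by (rule res_sum_Phi_zero[OF assms(2) assms(3)[OF that]])
  then have "((\<lambda>n. res_sum (Phi m n)) has_sum (\<Sum>n\<in>I. res_sum (Phi m n))) UNIV"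
    using assms(1) by (intro has_sum_finite_neutralI) auto
  then show ?thesis unfolding S_def by (rule infsumI)
qed

text \<open>Only \<open>n = 0\<close> and \<open>n = - 1\<close> contribute. There is a single plus
  pole for \<open>n = 0\<close> and a single minus pole for \<open>n = - 1\<close>; each contributes
  \<open>2 * Q\<close>, and \<open>Q\<close> is the right-hand side, since only the pairs containing
  6 have a nonzero index.\<close>

lemma base_half:
  assumes e1: "e = 1"
  defines "m \<equiv> \<lambda>k::nat. if k = 6 then - 1 else (0::int)"
  shows "S m = 4 * R m"
proof -
  define c where "c = \<alpha> 6"
  define J where "J = {1, 2, 3, 4, 5::nat}"
  define Q where "Q = (\<Prod>k\<in>J. 1 / (\<alpha> k + c))"
  have nz: "\<alpha> k + c \<noteq> 0" if "k \<in> {1..6}" for k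
    using add_int_nonzero[of k 6 0] that by (auto simp: c_def)
  have c: "2 * c \<noteq> 0" "2 * c - 1 \<noteq> 0"
    using add_int_nonzero[of 6 6 "- 1"] add_int_nonzero[of 6 6 0] by (auto simp: c_def)
  have sm: "(\<Sum>k=1..6. m k) = 2 - 3 * e"
    unfolding atLeastAtMost_1_6 by (simp add: m_def e1)
  have J: "finite J" "J \<subseteq> {1..6}" by (auto simp: J_def)
  have "S m = (\<Sum>n\<in>{0, - 1}. res_sum (Phi m n))"
    by (rule S_finite[OF _ sm]) (auto simp: m_def e1)
  also have "\<dots> = res_sum (Phi m 0) + res_sum (Phi m (- 1))" by simp
  also have "res_sum (Phi m 0) = 2 * Q"
  proof -
    have "res_sum (Phi m 0) = (\<Sum>x\<in>wpoles \<alpha> (\<lambda>k. m k + 0 + e - 1). residue (Phi m 0) x)"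
      unfolding integrand_def by (intro res_sum_times_W holomorphic_intros)
    also have "wpoles \<alpha> (\<lambda>k. m k + 0 + e - 1) = {- (2 * c)}"
      unfolding wpoles_altdef atLeastAtMost_1_6 by (auto simp: m_def e1 c_def)
    finally have "res_sum (Phi m 0) = residue (Phi m 0) (- (2 * c))" by simp
    also have "\<dots> = 2 * Q"
    proof -
      let ?h = "\<lambda>w. 2 * ((w * (w + 1)) * ((\<Prod>k\<in>J. 1 / (\<alpha> k - w / 2)) *
          (1 / ((c - w / 2) * (c - 1 - w / 2)))))"
      let ?X = "insert (2 * (c - 1)) ((\<lambda>k. 2 * \<alpha> k) ` {1..6})"
      have "Phi m 0 w = ((w * (w + 1)) * ((\<Prod>k\<in>J. 1 / (\<alpha> k - w / 2)) *
          (1 / ((c - w / 2) * (c - 1 - w / 2))))) * (1 / (c + w / 2))" for w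
        unfolding integrand_def W_def atLeastAtMost_1_6
        by (simp add: m_def e1 poch_int_0 poch_int_shifted c_def J_def)
      then have Phi: "Phi m 0 w = ?h w / (w - - (2 * c))" for w
        unfolding times_half_pole(1) .
      have x: "- (2 * c) \<notin> ?X"
      proof
        assume "- (2 * c) \<in> ?X"
        then consider "- (2 * c) = 2 * (c - 1)" | k where "k \<in> {1..6}" "- (2 * c) = 2 * \<alpha> k" by blast
        then show False
        proof cases
          case 1
          then have "2 * (2 * c - 1) = 0" by (simp add: algebra_simps)
          then show False using c by simp
        next
          case 2
          then have "- c = \<alpha> k" by simp
          then have "\<alpha> k + c = 0" by (metis add.left_inverse)
          then show False using nz[OF 2(1)] by simp
        qed
      qed
      have hol: "?h holomorphic_on - ?X"
      proof (intro holomorphic_intros)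
        fix w k assume w: "w \<in> - ?X" and "k \<in> J"
        then have "w \<noteq> 2 * \<alpha> k" using J by blast
        then show "\<alpha> k - w / 2 \<noteq> 0" unfolding half_eq_0_iff .
      next
        fix w assume w: "w \<in> - ?X"
        have "2 * c \<in> ?X" unfolding c_def by (rule insertI2, rule imageI) simp
        then have "w \<noteq> 2 * c" "w \<noteq> 2 * (c - 1)" using w by blast+
        then show "(c - w / 2) * (c - 1 - w / 2) \<noteq> 0"
          unfolding mult_eq_0_iff half_eq_0_iff by blast
      qed simp_all
      have "residue (Phi m 0) (- (2 * c)) = ?h (- (2 * c))"
        by (rule residue_simple_quotient[OF _ x hol Phi]) simp
      \<comment> \<open>At the pole, the polynomial \<open>w * (w + 1)\<close> cancels the
        minus-sign factor of index - 2 that belongs to \<open>k = 6\<close>.\<close>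
      also have "\<dots> = 2 * (((2 * c) * (2 * c - 1)) * (Q * (1 / ((2 * c) * (2 * c - 1)))))"
        by (simp add: Q_def algebra_simps)
      also have "\<dots> = 2 * Q" using c by simp
      finally show ?thesis .
    qed
    finally show ?thesis .
  qed
  also have "res_sum (Phi m (- 1)) = 2 * Q"
  proof -
    \<comment> \<open>Here the plus poles are many, so the one minus pole is used, with a minus
      sign.\<close>
    have "res_sum (Phi m (- 1)) = - (\<Sum>x\<in>uminus ` wpoles \<alpha> (\<lambda>k. m k - (- 1) - 1). residue (Phi m (- 1)) x)"
      using Phi_decay[OF sm] unfolding integrand_def
      by (intro res_sum_times_W_minus holomorphic_intros)
    also have "uminus ` wpoles \<alpha> (\<lambda>k. m k - (- 1) - 1) = {2 * c}"
      unfolding wpoles_altdef atLeastAtMost_1_6 by (auto simp: m_def e1 c_def)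
    finally have "res_sum (Phi m (- 1)) = - residue (Phi m (- 1)) (2 * c)" by simp
    also have "residue (Phi m (- 1)) (2 * c) = - (2 * Q)"
    proof -
      let ?h = "\<lambda>w. - 2 * ((w * (w - 1)) * ((\<Prod>k\<in>J. 1 / (\<alpha> k + w / 2)) *
          (1 / ((c + w / 2) * (c - 1 + w / 2)))))"
      let ?X = "insert (- (2 * (c - 1))) ((\<lambda>k. - (2 * \<alpha> k)) ` {1..6})"
      have "Phi m (- 1) w = ((w * (w - 1)) * ((\<Prod>k\<in>J. 1 / (\<alpha> k + w / 2)) *
          (1 / ((c + w / 2) * (c - 1 + w / 2))))) * (1 / (c - w / 2))" for w
        unfolding integrand_def W_def atLeastAtMost_1_6
        by (simp add: m_def e1 poch_int_0 poch_int_shifted c_def J_def)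
      then have Phi: "Phi m (- 1) w = ?h w / (w - 2 * c)" for w
        unfolding times_half_pole(2) .
      have x: "2 * c \<notin> ?X"
      proof
        assume "2 * c \<in> ?X"
        then consider "2 * c = - (2 * (c - 1))" | k where "k \<in> {1..6}" "2 * c = - (2 * \<alpha> k)" by blast
        then show False
        proof cases
          case 1
          then have "2 * (2 * c - 1) = 0" by (simp add: algebra_simps)
          then show False using c by simp
        next
          case 2
          then have "c = - \<alpha> k" by simp
          then have "\<alpha> k + c = 0" by simp
          then show False using nz[OF 2(1)] by simp
        qed
      qed
      have hol: "?h holomorphic_on - ?X"
      proof (intro holomorphic_intros)
        fix w k assume w: "w \<in> - ?X" and "k \<in> J"
        then have "w \<noteq> - (2 * \<alpha> k)" using J by blast
        then show "\<alpha> k + w / 2 \<noteq> 0" unfolding half_eq_0_iff .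
      next
        fix w assume w: "w \<in> - ?X"
        have "- (2 * c) \<in> ?X" unfolding c_def by (rule insertI2, rule imageI) simp
        then have "w \<noteq> - (2 * c)" "w \<noteq> - (2 * (c - 1))" using w by blast+
        then show "(c + w / 2) * (c - 1 + w / 2) \<noteq> 0"
          unfolding mult_eq_0_iff half_eq_0_iff by blast
      qed simp_all
      have "residue (Phi m (- 1)) (2 * c) = ?h (2 * c)"
        by (rule residue_simple_quotient[OF _ x hol Phi]) simp
      also have "\<dots> = - 2 * (((2 * c) * (2 * c - 1)) * (Q * (1 / ((2 * c) * (2 * c - 1)))))"
        by (simp add: Q_def algebra_simps)
      also have "\<dots> = - (2 * Q)" using c by simp
      finally show ?thesis .
    qed
    finally show ?thesis by simp
  qed
  also have "Q = R m"
    unfolding pair_product_def pairs_1_6 by (simp add: m_def e1 poch_int_0 poch_int_minus_1 Q_def J_def c_def)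
  finally show ?thesis by simp
qed

text \<open>Only \<open>n = 0\<close> contributes, with simple plus poles at -2 \<alpha>_k for k =
  3, ..., 6. Their residues add up to a divided difference of the square root, whose numerator is 1
  + \<alpha>_1 + \<alpha>_2 because all \<alpha>_k sum to - 1; this is the factor of the pair
  (1,2).\<close>

lemma base_zero:
  assumes e0: "e = 0"
  defines "m \<equiv> \<lambda>k::nat. if k \<le> 2 then 1 else (0::int)"
  shows "S m = 4 * R m"
proof -
  let ?J = "{3,4,5,6::nat}"
  have J: "k \<in> {1..6}" if "k \<in> ?J" for k using that by auto
  have nz: "\<alpha> j + \<alpha> k \<noteq> 0" if "j \<in> ?J" "k \<in> ?J" for j k
    using add_int_nonzero[OF J J, of j k 0] that by simp
  have nz': "\<alpha> j \<noteq> \<alpha> k" if "j \<in> ?J" "k \<in> ?J" "j \<noteq> k" for j k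
    using diff_notin_Ints[OF J J, of j k] that by auto
  have sm: "(\<Sum>k=1..6. m k) = 2 - 3 * e"
    unfolding atLeastAtMost_1_6 by (simp add: m_def e0)
  have "S m = (\<Sum>n\<in>{0}. res_sum (Phi m n))"
    by (rule S_finite[OF _ sm]) (auto simp: m_def e0)
  also have "\<dots> = res_sum (Phi m 0)" by simp
  also have "\<dots> = (\<Sum>x\<in>wpoles \<alpha> (\<lambda>k. m k + 0 + e - 1). residue (Phi m 0) x)"
    unfolding integrand_def by (intro res_sum_times_W holomorphic_intros)
  also have "wpoles \<alpha> (\<lambda>k. m k + 0 + e - 1) = (\<lambda>k. - (2 * \<alpha> k)) ` ?J"
    unfolding wpoles_altdef atLeastAtMost_1_6 by (auto simp: m_def e0)
  also have "(\<Sum>x\<in>(\<lambda>k. - (2 * \<alpha> k)) ` ?J. residue (Phi m 0) x) =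
      (\<Sum>k\<in>?J. residue (Phi m 0) (- (2 * \<alpha> k)))"
    using nz' by (subst sum.reindex) (auto simp: inj_on_def)
  also have "\<dots> = (\<Sum>k\<in>?J. 4 * (\<alpha> k / (\<Prod>j\<in>?J - {k}. (\<alpha> j - \<alpha> k) * (\<alpha> j + \<alpha> k))))"
  proof (rule sum.cong[OF refl])
    fix k assume k: "k \<in> ?J"
    let ?h = "\<lambda>w. 2 * (w * w * (\<Prod>j\<in>?J - {k}. 1 / ((\<alpha> j + w / 2) * (\<alpha> j - w / 2))) * (1 / (\<alpha> k - w / 2)))"
    let ?X = "(\<lambda>k. 2 * \<alpha> k) ` ?J \<union> (\<lambda>k. - (2 * \<alpha> k)) ` (?J - {k})"
    have "Phi m 0 w = w * w * (\<Prod>j\<in>?J. 1 / ((\<alpha> j + w / 2) * (\<alpha> j - w / 2)))" for w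
      unfolding integrand_def W_def atLeastAtMost_1_6
      by (simp add: m_def e0 poch_int_0 poch_int_shifted)
    moreover have "(\<Prod>j\<in>?J. 1 / ((\<alpha> j + w / 2) * (\<alpha> j - w / 2))) =
        1 / ((\<alpha> k + w / 2) * (\<alpha> k - w / 2)) * (\<Prod>j\<in>?J - {k}. 1 / ((\<alpha> j + w / 2) * (\<alpha> j - w / 2)))" for w
      by (rule prod.remove) (use k in auto)
    ultimately have "Phi m 0 w = w * w * (\<Prod>j\<in>?J - {k}. 1 / ((\<alpha> j + w / 2) * (\<alpha> j - w / 2))) *
        (1 / (\<alpha> k - w / 2)) * (1 / (\<alpha> k + w / 2))" for w
      by simp
    then have Phi: "Phi m 0 w = ?h w / (w - - (2 * \<alpha> k))" for w
      unfolding times_half_pole(1) .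
    have x: "- (2 * \<alpha> k) \<notin> ?X"
    proof
      assume "- (2 * \<alpha> k) \<in> ?X"
      then consider j where "j \<in> ?J" "- (2 * \<alpha> k) = 2 * \<alpha> j" | j where "j \<in> ?J - {k}" "- (2 * \<alpha> k) = - (2 * \<alpha> j)"
        by blast
      then show False
      proof cases
        case 1
        then have "- \<alpha> k = \<alpha> j" by simp
        then have "\<alpha> j + \<alpha> k = 0" by (metis add.left_inverse)
        then show False using nz[OF 1(1) k] by simp
      next
        case 2
        then show False using nz'[of k j] k by auto
      qed
    qed
    have hol: "?h holomorphic_on - ?X"
    proof (intro holomorphic_intros)
      fix w j assume w: "w \<in> - ?X" and j: "j \<in> ?J - {k}"
      have "w \<noteq> 2 * \<alpha> j" "w \<noteq> - (2 * \<alpha> j)" using w j by blast+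
      then show "(\<alpha> j + w / 2) * (\<alpha> j - w / 2) \<noteq> 0"
        unfolding mult_eq_0_iff half_eq_0_iff by blast
    next
      fix w assume w: "w \<in> - ?X"
      have "w \<noteq> 2 * \<alpha> k" using w k by blast
      then show "\<alpha> k - w / 2 \<noteq> 0" unfolding half_eq_0_iff .
    qed simp_all
    have "residue (Phi m 0) (- (2 * \<alpha> k)) = ?h (- (2 * \<alpha> k))"
      by (rule residue_simple_quotient[OF _ x hol Phi]) simp
    also have "\<dots> = 4 * \<alpha> k * (\<Prod>j\<in>?J - {k}. 1 / ((\<alpha> j - \<alpha> k) * (\<alpha> j + \<alpha> k)))"
      using nz[OF k k] by simp
    also have "(\<Prod>j\<in>?J - {k}. 1 / ((\<alpha> j - \<alpha> k) * (\<alpha> j + \<alpha> k))) = 1 / (\<Prod>j\<in>?J - {k}. (\<alpha> j - \<alpha> k) * (\<alpha> j + \<alpha> k))"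
      by (simp add: prod_dividef)
    finally show "residue (Phi m 0) (- (2 * \<alpha> k)) =
        4 * (\<alpha> k / (\<Prod>j\<in>?J - {k}. (\<alpha> j - \<alpha> k) * (\<alpha> j + \<alpha> k)))" by simp
  qed
  also have "\<dots> = 4 * (\<Sum>k\<in>?J. \<alpha> k / (\<Prod>j\<in>?J - {k}. (\<alpha> j - \<alpha> k) * (\<alpha> j + \<alpha> k)))"
    by (rule sum_distrib_left[symmetric])
  also have "(\<Sum>k\<in>?J. \<alpha> k / (\<Prod>j\<in>?J - {k}. (\<alpha> j - \<alpha> k) * (\<alpha> j + \<alpha> k))) = \<alpha> 3 / (((\<alpha> 4 - \<alpha> 3) * (\<alpha> 4 + \<alpha> 3)) * ((\<alpha> 5 - \<alpha> 3) * (\<alpha> 5 + \<alpha> 3)) * ((\<alpha> 6 - \<alpha> 3) * (\<alpha> 6 + \<alpha> 3))) +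
      \<alpha> 4 / (((\<alpha> 3 - \<alpha> 4) * (\<alpha> 3 + \<alpha> 4)) * ((\<alpha> 5 - \<alpha> 4) * (\<alpha> 5 + \<alpha> 4)) * ((\<alpha> 6 - \<alpha> 4) * (\<alpha> 6 + \<alpha> 4))) +
      \<alpha> 5 / (((\<alpha> 3 - \<alpha> 5) * (\<alpha> 3 + \<alpha> 5)) * ((\<alpha> 4 - \<alpha> 5) * (\<alpha> 4 + \<alpha> 5)) * ((\<alpha> 6 - \<alpha> 5) * (\<alpha> 6 + \<alpha> 5))) +
      \<alpha> 6 / (((\<alpha> 3 - \<alpha> 6) * (\<alpha> 3 + \<alpha> 6)) * ((\<alpha> 4 - \<alpha> 6) * (\<alpha> 4 + \<alpha> 6)) * ((\<alpha> 5 - \<alpha> 6) * (\<alpha> 5 + \<alpha> 6)))"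
    by (simp add: insert_Diff_if mult.assoc)
  also have "\<dots> = - (\<alpha> 3 + \<alpha> 4 + \<alpha> 5 + \<alpha> 6) /
      ((\<alpha> 3 + \<alpha> 4) * (\<alpha> 3 + \<alpha> 5) * (\<alpha> 3 + \<alpha> 6) * (\<alpha> 4 + \<alpha> 5) * (\<alpha> 4 + \<alpha> 6) * (\<alpha> 5 + \<alpha> 6))"
    by (rule square_root_divided_difference) ((rule nz', simp, simp, simp)+, (rule nz, simp, simp)+)
  also have "- (\<alpha> 3 + \<alpha> 4 + \<alpha> 5 + \<alpha> 6) = 1 + \<alpha> 1 + \<alpha> 2"
  proof -
    have "\<alpha> 1 + (\<alpha> 2 + (\<alpha> 3 + (\<alpha> 4 + (\<alpha> 5 + \<alpha> 6)))) = - 1"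
      using sum_\<alpha> unfolding atLeastAtMost_1_6 by simp
    then show ?thesis by algebra
  qed
  also have "(1 + \<alpha> 1 + \<alpha> 2) /
      ((\<alpha> 3 + \<alpha> 4) * (\<alpha> 3 + \<alpha> 5) * (\<alpha> 3 + \<alpha> 6) * (\<alpha> 4 + \<alpha> 5) * (\<alpha> 4 + \<alpha> 6) * (\<alpha> 5 + \<alpha> 6)) = R m"
    unfolding pair_product_def pairs_1_6 by (simp add: m_def e0 poch_int_0 poch_int_1 poch_int_minus_1 mult_ac)
  finally show ?thesis .
qed

lemma S_eq_R:
  assumes m: "(\<Sum>k=1..6. m k) = 2 - 3 * e"
  shows "S m = 4 * R m"
proof (cases "e = 0")
  case True
  let ?m0 = "\<lambda>k::nat. if k \<le> 2 then 1 else (0::int)"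
  have "(\<Sum>k=1..6. ?m0 k) = 2 - 3 * e"
    unfolding atLeastAtMost_1_6 by (simp add: True)
  then show ?thesis using base_zero[OF True] m by (rule S_eq_R_induct)
next
  case False
  then have e1: "e = 1" using e by simp
  let ?m0 = "\<lambda>k::nat. if k = 6 then - 1 else (0::int)"
  have "(\<Sum>k=1..6. ?m0 k) = 2 - 3 * e"
    unfolding atLeastAtMost_1_6 by (simp add: e1)
  then show ?thesis using base_half[OF e1] m by (rule S_eq_R_induct)
qed

end

section \<open>Perturbation of the parameters\<close>

text \<open>The weights have sum zero, and all their pairwise sums and differences are nonzero.\<close>
definition perturbed :: "(nat \<Rightarrow> complex) \<Rightarrow> complex \<Rightarrow> nat \<Rightarrow> complex" where
  "perturbed \<alpha> t k = \<alpha> k + t * (if k = 6 then - 15 else of_nat k)"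

lemma perturbed_0 [simp]: "perturbed \<alpha> 0 = \<alpha>"
  by (simp add: perturbed_def fun_eq_iff)

lemma sum_perturbed: "(\<Sum>k=1..6. perturbed \<alpha> t k) = (\<Sum>k=1..6. \<alpha> k)"
  unfolding atLeastAtMost_1_6 by (simp add: perturbed_def algebra_simps)

text \<open>Each condition keeps a linear function of \<open>t\<close> with nonzero slope off the
  integers; there are finitely many, and each holds for all small nonzero \<open>t\<close>.\<close>

lemma eventually_generic:
  assumes e: "e = 0 \<or> e = 1" and sum: "(\<Sum>k=1..6. \<alpha> k) = - 1"
  shows "\<forall>\<^sub>F t in at 0. generic_parameters (perturbed \<alpha> t) e"
proof -
  let ?v = "\<lambda>k::nat. if k = 6 then - 15 else complex_of_nat k"
  have v: "?v j + ?v k \<noteq> 0" "j \<noteq> k \<longrightarrow> ?v j - ?v k \<noteq> 0" if "j \<in> {1..6}" "k \<in> {1..6}" for j k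
    using that unfolding atLeastAtMost_1_6 by auto
  have "\<forall>\<^sub>F t in at 0. \<forall>j\<in>{1..6}. \<forall>k\<in>{1..6}. (\<alpha> j + \<alpha> k) + (?v j + ?v k) * t \<notin> \<int>"
    using v by (intro eventually_ball_finite ballI eventually_linear_notin_Ints) auto
  moreover have "\<forall>\<^sub>F t in at 0. \<forall>j\<in>{1..6}. \<forall>k\<in>{1..6}. j \<noteq> k \<longrightarrow> (\<alpha> j - \<alpha> k) + (?v j - ?v k) * t \<notin> \<int>"
  proof (intro eventually_ball_finite ballI)
    fix j k :: nat assume jk: "j \<in> {1..6}" "k \<in> {1..6}"
    show "\<forall>\<^sub>F t in at 0. j \<noteq> k \<longrightarrow> (\<alpha> j - \<alpha> k) + (?v j - ?v k) * t \<notin> \<int>"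
    proof (cases "j = k")
      case False
      then have nz: "?v j - ?v k \<noteq> 0" using v(2)[OF jk] by blast
      show ?thesis
        using eventually_linear_notin_Ints[OF nz] by (rule eventually_mono) blast
    qed simp
  qed simp_all
  ultimately show ?thesis
  proof eventually_elim
    case (elim t)
    show ?case
    proof
      fix j k :: nat assume jk: "j \<in> {1..6}" "k \<in> {1..6}"
      have "perturbed \<alpha> t j + perturbed \<alpha> t k = (\<alpha> j + \<alpha> k) + (?v j + ?v k) * t"
        unfolding perturbed_def by (simp only: algebra_simps)
      then show "perturbed \<alpha> t j + perturbed \<alpha> t k \<notin> \<int>"
        using elim(1) jk by metis
      have "perturbed \<alpha> t j - perturbed \<alpha> t k = (\<alpha> j - \<alpha> k) + (?v j - ?v k) * t"
        unfolding perturbed_def by (simp only: algebra_simps)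
      then show "perturbed \<alpha> t j - perturbed \<alpha> t k \<notin> \<int>" if "j \<noteq> k"
        using elim(2) jk that by metis
    qed (use e sum in \<open>unfold sum_perturbed, blast+\<close>)
  qed
qed

text \<open>For fixed \<open>k\<close> and \<open>j\<close> the pole moves by -2 t times the weight
  of \<open>k\<close>, and the weights are at most 15 in absolute value.\<close>

lemma wpoles_perturbed:
  assumes "x \<in> wpoles (perturbed \<alpha> t) p"
  obtains x0 where "x0 \<in> wpoles \<alpha> p" "dist x x0 \<le> 30 * norm t"
proof -
  let ?v = "\<lambda>k::nat. if k = 6 then - 15 else complex_of_nat k"
  obtain k j where k: "k \<in> {1..6}" and j: "1 \<le> j" "j \<le> - p k" "1 + perturbed \<alpha> t k + x / 2 = of_int j"
    using assms by (auto simp: wpoles_def)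
  define u where "u = ?v k"
  define x0 where "x0 = x + 2 * t * u"
  have "perturbed \<alpha> t k = \<alpha> k + t * u" by (simp add: perturbed_def u_def)
  then have "1 + \<alpha> k + x0 / 2 = 1 + perturbed \<alpha> t k + x / 2"
    by (simp add: x0_def add_divide_distrib)
  then have "1 + \<alpha> k + x0 / 2 = of_int j" unfolding j(3) .
  then have "x0 \<in> wpoles \<alpha> p" using k j by (auto simp: wpoles_def)
  moreover have "norm u \<le> 15" using k by (auto simp: u_def)
  then have "2 * norm t * norm u \<le> 2 * norm t * 15" by (intro mult_left_mono) auto
  then have "dist x x0 \<le> 30 * norm t"
    by (simp add: x0_def dist_norm norm_mult)
  ultimately show ?thesis using that by blast
qed

section \<open>Integrals over fixed closed paths as functions of the parameters\<close>

text \<open>The integrand in the original variable y, with \<open>c\<close> in the role of N and the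
  polynomial as \<open>r\<close>.\<close>

definition shifted_W ::
  "(complex \<Rightarrow> complex) \<Rightarrow> (nat \<Rightarrow> int) \<Rightarrow> (nat \<Rightarrow> int) \<Rightarrow> complex \<Rightarrow> (nat \<Rightarrow> complex) \<Rightarrow> complex \<Rightarrow> complex" where
  "shifted_W r p q c \<alpha> y = r (y - c) * W \<alpha> p q (y - c)"

lemma holomorphic_on_shifted_W:
  assumes "r holomorphic_on UNIV"
  shows "shifted_W r p q c \<alpha> holomorphic_on
    - ((\<lambda>x. x + c) ` wpoles \<alpha> p \<union> (\<lambda>x. x + c) ` uminus ` wpoles \<alpha> q)" (is "_ holomorphic_on ?A")
proof -
  have sub: "(\<lambda>y. y - c) ` ?A \<subseteq> - (wpoles \<alpha> p \<union> uminus ` wpoles \<alpha> q)"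
  proof safe
    fix y x assume y: "y \<notin> (\<lambda>x. x + c) ` wpoles \<alpha> p" "y - c \<in> wpoles \<alpha> p"
    then have "y = (y - c) + c" by simp
    then show False using y by blast
  next
    fix y x assume y: "y \<notin> (\<lambda>x. x + c) ` uminus ` wpoles \<alpha> q" "y - c = - x" "x \<in> wpoles \<alpha> q"
    then have "y = - x + c" by (simp add: algebra_simps)
    then show False using y by blast
  qed
  have h: "(\<lambda>w. r w * W \<alpha> p q w) holomorphic_on - (wpoles \<alpha> p \<union> uminus ` wpoles \<alpha> q)"
    using assms by (intro holomorphic_on_mult holomorphic_on_W) (auto elim: holomorphic_on_subset)
  have "((\<lambda>w. r w * W \<alpha> p q w) \<circ> (\<lambda>y. y - c)) holomorphic_on ?A"
    by (rule holomorphic_on_compose_gen[OF _ h sub]) (intro holomorphic_intros)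
  then show ?thesis by (simp add: o_def shifted_W_def[abs_def])
qed

lemma residue_shifted_W:
  "residue (shifted_W r p q c \<alpha>) (x + c) = residue (\<lambda>w. r w * W \<alpha> p q w) x"
  by (simp add: residue_shift_0[of "shifted_W r p q c \<alpha>"] residue_shift_0[of "\<lambda>w. r w * W \<alpha> p q w"]
      shifted_W_def algebra_simps)

definition separates :: "(real \<Rightarrow> complex) \<Rightarrow> complex set \<Rightarrow> complex set \<Rightarrow> bool" where
  "separates \<gamma> P M \<longleftrightarrow> path_image \<gamma> \<inter> (P \<union> M) = {} \<and>
    (\<forall>p\<in>P. winding_number \<gamma> p = 1) \<and> (\<forall>p\<in>M. winding_number \<gamma> p = 0)"

lemma contour_integral_shifted_W:
  assumes r: "r holomorphic_on UNIV" and \<gamma>: "valid_path \<gamma>" "pathfinish \<gamma> = pathstart \<gamma>"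
    and sep: "separates \<gamma> ((\<lambda>x. x + c) ` wpoles \<alpha> p) ((\<lambda>x. x + c) ` uminus ` wpoles \<alpha> q)"
  shows "contour_integral \<gamma> (shifted_W r p q c \<alpha>) =
    2 * pi * \<i> * (\<Sum>x\<in>wpoles \<alpha> p. residue (\<lambda>w. r w * W \<alpha> p q w) x)"
proof -
  let ?P = "(\<lambda>x. x + c) ` wpoles \<alpha> p" and ?M = "(\<lambda>x. x + c) ` uminus ` wpoles \<alpha> q"
  let ?f = "shifted_W r p q c \<alpha>"
  have fin: "finite ?P" "finite ?M" using finite_wpoles by auto
  have "contour_integral \<gamma> ?f = 2 * pi * \<i> * (\<Sum>x\<in>?P \<union> ?M. winding_number \<gamma> x * residue ?f x)"
    using holomorphic_on_shifted_W[OF r] \<gamma> sep fin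
    by (intro Residue_theorem[where S = UNIV]) (auto simp: Compl_eq_Diff_UNIV separates_def)
  also have "(\<Sum>x\<in>?P \<union> ?M. winding_number \<gamma> x * residue ?f x) = (\<Sum>x\<in>?P. residue ?f x)"
    using sep fin by (intro sum.mono_neutral_cong_right) (auto simp: separates_def)
  also have "\<dots> = (\<Sum>x\<in>wpoles \<alpha> p. residue (\<lambda>w. r w * W \<alpha> p q w) x)"
    by (subst sum.reindex) (auto simp: inj_on_def residue_shifted_W)
  finally show ?thesis .
qed

lemma eventually_norm_small: "\<delta> > 0 \<Longrightarrow> \<forall>\<^sub>F t in nhds (0::complex). 30 * norm t < \<delta>"
  by (auto simp: eventually_nhds_metric dist_norm intro!: exI[of _ "\<delta> / 30"])

text \<open>The sets of points with a given winding number are open, so each finite pole set has a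
  positive margin in them, and poles move by at most 30 |t|.\<close>

lemma eventually_separates:
  assumes \<gamma>: "valid_path \<gamma>" "pathfinish \<gamma> = pathstart \<gamma>"
    and sep: "separates \<gamma> ((\<lambda>x. x + c) ` wpoles \<alpha> p) ((\<lambda>x. x + c) ` uminus ` wpoles \<alpha> q)"
  shows "\<forall>\<^sub>F t in nhds 0. separates \<gamma> ((\<lambda>x. x + c) ` wpoles (perturbed \<alpha> t) p)
    ((\<lambda>x. x + c) ` uminus ` wpoles (perturbed \<alpha> t) q)"
proof -
  define U where "U k = {z. z \<notin> path_image \<gamma> \<and> winding_number \<gamma> z = k}" for k
  have op: "open (U k)" for k
    unfolding U_def using \<gamma> by (intro open_winding_number_levelsets) (auto simp: valid_path_imp_path)
  let ?P = "(\<lambda>x. x + c) ` wpoles \<alpha> p" and ?M = "(\<lambda>x. x + c) ` uminus ` wpoles \<alpha> q"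
  have "compact ?P" "compact ?M" using finite_wpoles by (auto intro!: finite_imp_compact)
  moreover have "?P \<subseteq> U 1" "?M \<subseteq> U 0" using sep unfolding separates_def U_def by blast+
  ultimately obtain d1 d2 where d: "d1 > 0" "(\<Union>x\<in>?P. ball x d1) \<subseteq> U 1" "d2 > 0" "(\<Union>x\<in>?M. ball x d2) \<subseteq> U 0"
    by (metis compact_subset_open_imp_ball_epsilon_subset op)
  show ?thesis
    using eventually_norm_small[OF d(1)] eventually_norm_small[OF d(3)]
  proof eventually_elim
    case (elim t)
    have "x + c \<in> U 1" if "x \<in> wpoles (perturbed \<alpha> t) p" for x
    proof -
      obtain x0 where "x0 \<in> wpoles \<alpha> p" "dist x x0 \<le> 30 * norm t"
        using wpoles_perturbed[OF \<open>x \<in> _\<close>] .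
      then have "x0 + c \<in> ?P" "x + c \<in> ball (x0 + c) d1"
        using elim by (auto simp: dist_commute)
      then show ?thesis using d by blast
    qed
    moreover have "- x + c \<in> U 0" if "x \<in> wpoles (perturbed \<alpha> t) q" for x
    proof -
      obtain x0 where "x0 \<in> wpoles \<alpha> q" "dist x x0 \<le> 30 * norm t"
        using wpoles_perturbed[OF \<open>x \<in> _\<close>] .
      moreover have "dist (- x0 + c) (- x + c) = dist x x0" by (simp add: dist_norm)
      ultimately have "- x0 + c \<in> ?M" "- x + c \<in> ball (- x0 + c) d2"
        using elim by auto
      then show ?thesis using d by blast
    qed
    ultimately show ?case unfolding separates_def U_def by blast
  qed
qed

text \<open>Near the path the integrand is jointly continuous in the parameter and the variable. On
  a compact set it is thus uniformly continuous, and the integrands converge uniformly.\<close>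

lemma contour_integral_shifted_W_tendsto:
  assumes r: "r holomorphic_on UNIV" and \<gamma>: "valid_path \<gamma>"
    and dis: "path_image \<gamma> \<inter> ((\<lambda>x. x + c) ` wpoles \<alpha> p \<union> (\<lambda>x. x + c) ` uminus ` wpoles \<alpha> q) = {}"
  shows "((\<lambda>t. contour_integral \<gamma> (shifted_W r p q c (perturbed \<alpha> t))) \<longlongrightarrow>
    contour_integral \<gamma> (shifted_W r p q c \<alpha>)) (at 0)"
proof -
  let ?Z = "\<lambda>t. (\<lambda>x. x + c) ` wpoles (perturbed \<alpha> t) p \<union> (\<lambda>x. x + c) ` uminus ` wpoles (perturbed \<alpha> t) q"
  let ?f = "\<lambda>t. shifted_W r p q c (perturbed \<alpha> t)"
  have fin: "finite (?Z t)" for t using finite_wpoles by auto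
  have "compact (path_image \<gamma>)" using \<gamma> by (simp add: compact_path_image valid_path_imp_path)
  moreover have "open (- ?Z 0)" using fin by (intro open_Compl finite_imp_closed)
  moreover have "path_image \<gamma> \<subseteq> - ?Z 0" using dis by auto
  ultimately obtain d where d: "d > 0" "(\<Union>x\<in>path_image \<gamma>. ball x d) \<subseteq> - ?Z 0"
    by (rule compact_subset_open_imp_ball_epsilon_subset)
  define K where "K = (\<Union>x\<in>path_image \<gamma>. cball x (d / 3))"
  define V where "V = (\<Union>x\<in>path_image \<gamma>. ball x (d / 3))"
  have K: "compact K" unfolding K_def using \<gamma> by (intro compact_minkowski_sum_cball compact_path_image) (simp add: valid_path_imp_path)
  have V: "open V" "V \<subseteq> K" "path_image \<gamma> \<subseteq> V"
    using d by (auto simp: V_def K_def)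
  \<comment> \<open>For such parameters the poles move by at most d/3, while \<open>K\<close> keeps
    distance 2d/3 from the unperturbed ones.\<close>
  define \<rho> where "\<rho> = d / 90"
  have \<rho>: "\<rho> > 0" using d by (simp add: \<rho>_def)
  have far: "dist y z \<ge> 2 * d / 3" if yz: "y \<in> K" "z \<in> ?Z 0" for y z
  proof (rule ccontr)
    assume "\<not> ?thesis"
    moreover obtain x where x: "x \<in> path_image \<gamma>" "dist x y \<le> d / 3" using yz(1) by (auto simp: K_def)
    ultimately have "z \<in> ball x d" using dist_triangle[of x z y] by auto
    then show False using d x yz by blast
  qed
  have KZ: "y \<notin> ?Z t" if t: "norm t \<le> \<rho>" and y: "y \<in> K" for t y
  proof
    assume "y \<in> ?Z t"
    then obtain z where "z \<in> ?Z 0" "dist y z \<le> 30 * norm t"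
    proof
      assume "y \<in> (\<lambda>x. x + c) ` wpoles (perturbed \<alpha> t) p"
      then obtain x where x: "y = x + c" "x \<in> wpoles (perturbed \<alpha> t) p" by blast
      obtain x0 where "x0 \<in> wpoles \<alpha> p" "dist x x0 \<le> 30 * norm t"
        using wpoles_perturbed[OF x(2)] .
      then show thesis using x by (intro that[of "x0 + c"]) auto
    next
      assume "y \<in> (\<lambda>x. x + c) ` uminus ` wpoles (perturbed \<alpha> t) q"
      then obtain x where x: "y = - x + c" "x \<in> wpoles (perturbed \<alpha> t) q" by blast
      obtain x0 where "x0 \<in> wpoles \<alpha> q" "dist x x0 \<le> 30 * norm t"
        using wpoles_perturbed[OF x(2)] .
      moreover have "dist (- x + c) (- x0 + c) = dist x x0" by (simp add: dist_norm norm_minus_commute)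
      ultimately show thesis using x by (intro that[of "- x0 + c"]) auto
    qed
    then show False using far[OF y] t d by (fastforce simp: \<rho>_def)
  qed
  have hol: "?f t holomorphic_on V" if "norm t \<le> \<rho>" for t
    by (rule holomorphic_on_subset[OF holomorphic_on_shifted_W[OF r]]) (use KZ[OF that] V in blast)
  have "continuous_on (cball 0 \<rho> \<times> K) (\<lambda>z. ?f (fst z) (snd z))"
  proof -
    have np: "1 + perturbed \<alpha> t k + (y - c) / 2 \<noteq> of_int j"
      if "norm t \<le> \<rho>" "y \<in> K" "k \<in> {1..6}" "1 \<le> j" "j \<le> - p k" for t y k j
    proof
      assume "1 + perturbed \<alpha> t k + (y - c) / 2 = of_int j"
      then have "y - c \<in> wpoles (perturbed \<alpha> t) p" using that by (auto simp: wpoles_def)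
      then have "(y - c) + c \<in> ?Z t" by blast
      then show False using KZ[OF that(1,2)] by simp
    qed
    have nq: "1 + perturbed \<alpha> t k - (y - c) / 2 \<noteq> of_int j"
      if "norm t \<le> \<rho>" "y \<in> K" "k \<in> {1..6}" "1 \<le> j" "j \<le> - q k" for t y k j
    proof
      assume "1 + perturbed \<alpha> t k - (y - c) / 2 = of_int j"
      then have "1 + perturbed \<alpha> t k + (- (y - c)) / 2 = of_int j"
        by (simp only: minus_divide_left[symmetric] add_uminus_conv_diff)
      then have "- (y - c) \<in> wpoles (perturbed \<alpha> t) q" using that unfolding wpoles_def by blast
      then have "- (- (y - c)) + c \<in> ?Z t" by blast
      then show False using KZ[OF that(1,2)] by simp
    qed
    have "continuous_on UNIV r" using r by (rule holomorphic_on_imp_continuous_on)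
    then have "continuous_on (cball 0 \<rho> \<times> K) (\<lambda>z. r (snd z - c))"
      by (rule continuous_on_compose2) (auto intro!: continuous_intros)
    moreover have "continuous_on (cball 0 \<rho> \<times> K) (\<lambda>z. perturbed \<alpha> (fst z) k)" for k
      unfolding perturbed_def by (intro continuous_intros)
    ultimately show ?thesis
      unfolding shifted_W_def W_def using np nq
      by (intro continuous_on_mult continuous_on_prod continuous_on_poch_int)
         (auto intro!: continuous_intros)
  qed
  then have uc: "uniformly_continuous_on (cball 0 \<rho> \<times> K) (\<lambda>z. ?f (fst z) (snd z))"
    using K by (intro compact_uniformly_continuous compact_Times) auto
  \<comment> \<open>One constant \<open>L\<close>, a substitute for the length of the path, serves
    for all functions holomorphic on the neighbourhood \<open>V\<close>.\<close>
  obtain L where L: "L > 0" "\<And>h B. h holomorphic_on V \<Longrightarrow> (\<forall>z\<in>V. norm (h z) \<le> B) \<Longrightarrow>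
      norm (contour_integral \<gamma> h) \<le> L * B"
    using contour_integral_bound_exists[OF V(1) \<gamma> V(3)] by blast
  show ?thesis
  proof (rule tendstoI)
    fix \<epsilon> :: real assume \<epsilon>: "\<epsilon> > 0"
    then have "\<epsilon> / (2 * L) > 0" using L by simp
    then obtain \<eta> where \<eta>: "\<eta> > 0" "\<And>z z'. z \<in> cball 0 \<rho> \<times> K \<Longrightarrow> z' \<in> cball 0 \<rho> \<times> K \<Longrightarrow> dist z' z < \<eta> \<Longrightarrow>
        dist (?f (fst z') (snd z')) (?f (fst z) (snd z)) < \<epsilon> / (2 * L)"
      using uc unfolding uniformly_continuous_on_def by blast
    have "\<forall>\<^sub>F t in at 0. norm t < min \<rho> \<eta>"
      using \<rho> \<eta>(1) by (auto simp: eventually_at dist_norm intro!: exI[of _ "min \<rho> \<eta>"])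
    then show "\<forall>\<^sub>F t in at 0. dist (contour_integral \<gamma> (?f t)) (contour_integral \<gamma> (shifted_W r p q c \<alpha>)) < \<epsilon>"
    proof eventually_elim
      case (elim t)
      have h: "?f t holomorphic_on V" "?f 0 holomorphic_on V" using hol[of t] hol[of 0] elim \<rho> by auto
      have ci: "?f t contour_integrable_on \<gamma>" "?f 0 contour_integrable_on \<gamma>"
        using h V \<gamma> by (auto intro!: contour_integrable_holomorphic_simple)
      have "norm (contour_integral \<gamma> (\<lambda>y. ?f t y - ?f 0 y)) \<le> L * (\<epsilon> / (2 * L))"
      proof (rule L(2))
        show "\<forall>y\<in>V. norm (?f t y - ?f 0 y) \<le> \<epsilon> / (2 * L)"
        proof
          fix y assume "y \<in> V"
          then have "y \<in> K" using V by blast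
          then show "norm (?f t y - ?f 0 y) \<le> \<epsilon> / (2 * L)"
            using \<eta>(2)[of "(0, y)" "(t, y)"] elim \<rho> by (simp add: dist_norm dist_Pair_Pair)
        qed
      qed (intro holomorphic_intros h)
      then have "norm (contour_integral \<gamma> (?f t) - contour_integral \<gamma> (?f 0)) \<le> \<epsilon> / 2"
        using ci L by (simp add: contour_integral_diff)
      then show ?case using \<epsilon> by (simp add: dist_norm)
    qed
  qed
qed

lemma pair_product_tendsto:
  assumes "\<And>j k i. 1 \<le> j \<Longrightarrow> j < k \<Longrightarrow> k \<le> 6 \<Longrightarrow> 1 \<le> i \<Longrightarrow> i \<le> - (m j + m k + e - 1) \<Longrightarrow>
      1 + \<alpha> j + \<alpha> k \<noteq> of_int i"
  shows "((\<lambda>t. pair_product (perturbed \<alpha> t) e m) \<longlongrightarrow> pair_product \<alpha> e m) (at 0)"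
proof -
  have p: "((\<lambda>t. perturbed \<alpha> t k) \<longlongrightarrow> \<alpha> k) (at 0)" for k
  proof -
    have "((\<lambda>t. perturbed \<alpha> t k) \<longlongrightarrow> \<alpha> k + 0 * (if k = 6 then - 15 else of_nat k)) (at 0)"
      unfolding perturbed_def by (intro tendsto_intros)
    then show ?thesis by simp
  qed
  show ?thesis
    unfolding pair_product_def case_prod_unfold
  proof (intro tendsto_prod tendsto_poch_int tendsto_add tendsto_const p)
    fix jk :: "nat \<times> nat" and i :: int
    assume "jk \<in> {x. 1 \<le> fst x \<and> fst x < snd x \<and> snd x \<le> 6}"
      "1 \<le> i" "i \<le> - (m (fst jk) + m (snd jk) + e - 1)"
    then show "1 + \<alpha> (fst jk) + \<alpha> (snd jk) \<noteq> of_int i"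
      using assms by simp
  qed
qed

text \<open>A zero of a denominator of the right-hand side gives a point that is both a plus and a minus pole,
  for \<open>n = m k\<close>.\<close>
lemma pair_product_nonsingular:
  assumes dis: "\<And>n. wpoles \<alpha> (\<lambda>k. m k + n + e - 1) \<inter> uminus ` wpoles \<alpha> (\<lambda>k. m k - n - 1) = {}"
    and jk: "1 \<le> j" "j < k" "k \<le> (6::nat)" and i: "1 \<le> i" "i \<le> - (m j + m k + e - 1)"
  shows "1 + \<alpha> j + \<alpha> k \<noteq> of_int i"
proof
  assume eq: "1 + \<alpha> j + \<alpha> k = of_int i"
  define w where "w = 2 * (of_int i - 1 - \<alpha> j)"
  have w2: "w / 2 = of_int i - 1 - \<alpha> j"
    unfolding w_def by (rule nonzero_mult_div_cancel_left) simp
  have "1 + \<alpha> j + w / 2 = of_int i" unfolding w2 by simp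
  then have "w \<in> wpoles \<alpha> (\<lambda>l. m l + m k + e - 1)"
    using jk i unfolding wpoles_def by (intro CollectI bexI[of _ j] exI[of _ i]) auto
  moreover have "1 + \<alpha> k + (- w) / 2 = of_int 1"
    unfolding minus_divide_left[symmetric] w2 eq[symmetric] by simp
  then have "- w \<in> wpoles \<alpha> (\<lambda>l. m l - m k - 1)"
    using jk unfolding wpoles_def by (intro CollectI bexI[of _ k] exI[of _ 1]) auto
  then have "w \<in> uminus ` wpoles \<alpha> (\<lambda>l. m l - m k - 1)"
    by (metis imageI minus_minus)
  ultimately show False using dis[of "m k"] by blast
qed

text \<open>With w = y - c, y^2 = w^2 + 2 c w + c^2, so the decay in \<open>w\<close> is needed for
  the powers 2, 1 and 0.\<close>

lemma integrand_shifted_decay: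
  assumes "(\<Sum>k=1..6. m k) = 2 - 3 * e"
  shows "((\<lambda>y. y ^ 2 * integrand \<alpha> e m n (y - c)) \<longlongrightarrow> 0) at_infinity"
proof -
  let ?f = "integrand \<alpha> e m n"
  have "((\<lambda>w. w ^ 2 * ?f w + 2 * c * (w ^ 1 * ?f w) + c ^ 2 * (w ^ 0 * ?f w)) \<longlongrightarrow>
      0 + 2 * c * 0 + c ^ 2 * 0) at_infinity"
    by (intro tendsto_intros integrand_decay[OF assms]) auto
  moreover have "filterlim (\<lambda>y. - c + y) at_infinity at_infinity"
    by (rule tendsto_add_filterlim_at_infinity[OF tendsto_const filterlim_ident])
  ultimately have "((\<lambda>y. (- c + y) ^ 2 * ?f (- c + y) + 2 * c * ((- c + y) ^ 1 * ?f (- c + y)) +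
      c ^ 2 * ((- c + y) ^ 0 * ?f (- c + y))) \<longlongrightarrow> 0 + 2 * c * 0 + c ^ 2 * 0) at_infinity"
    by (rule filterlim_compose)
  moreover have "(- c + y) ^ 2 * ?f (- c + y) + 2 * c * ((- c + y) ^ 1 * ?f (- c + y)) +
      c ^ 2 * ((- c + y) ^ 0 * ?f (- c + y)) = y ^ 2 * ?f (y - c)" for y
  proof -
    have "- c + y = y - c" by simp
    then show ?thesis by (simp add: power2_eq_square algebra_simps)
  qed
  ultimately show ?thesis by simp
qed

text \<open>Each integral is 2 pi i times a residue sum over plus poles; the terms outside the range
  vanish, so the total is 2 pi i times \<open>S m\<close>.\<close>

lemma sum_contour_integrals_generic:
  assumes gen: "generic_parameters \<alpha> e" and m: "(\<Sum>k=1..6. m k) = 2 - 3 * e"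
  defines "B \<equiv> (\<Sum>k=1..6. \<bar>m k\<bar>)"
  assumes \<gamma>: "\<And>n. valid_path (\<gamma> n)" "\<And>n. pathfinish (\<gamma> n) = pathstart (\<gamma> n)"
    and sep: "\<And>n. n \<in> {- B - 1..B + 1} \<Longrightarrow>
      separates (\<gamma> n) ((\<lambda>x. x + c n) ` wpoles \<alpha> (\<lambda>k. m k + n + e - 1))
        ((\<lambda>x. x + c n) ` uminus ` wpoles \<alpha> (\<lambda>k. m k - n - 1))"
  shows "(\<Sum>n\<in>{- B - 1..B + 1}. contour_integral (\<gamma> n)
      (shifted_W (\<lambda>w. w * (w + of_int (2 * n + e))) (\<lambda>k. m k + n + e - 1) (\<lambda>k. m k - n - 1) (c n) \<alpha>)) =
    8 * pi * \<i> * pair_product \<alpha> e m"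
proof -
  interpret generic_parameters \<alpha> e by fact
  have hol: "(\<lambda>w. w * (w + of_int (2 * n + e))) holomorphic_on UNIV" for n
    by (intro holomorphic_intros)
  have res: "res_sum (Phi m n) = (\<Sum>x\<in>wpoles \<alpha> (\<lambda>k. m k + n + e - 1).
      residue (\<lambda>w. (w * (w + of_int (2 * n + e))) * W \<alpha> (\<lambda>k. m k + n + e - 1) (\<lambda>k. m k - n - 1) w) x)" for n
    unfolding integrand_def by (rule res_sum_times_W[OF hol])
  have "S m = (\<Sum>n\<in>{- B - 1..B + 1}. res_sum (Phi m n))"
  proof (rule S_finite[OF _ m])
    fix n assume "n \<notin> {- B - 1..B + 1}"
    then show "(\<forall>k\<in>{1..6}. 0 \<le> m k + n + e - 1) \<or> (\<forall>k\<in>{1..6}. 0 \<le> m k - n - 1)"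
      using large_index[of n m] e unfolding B_def by force
  qed simp
  then have "8 * pi * \<i> * R m = (\<Sum>n\<in>{- B - 1..B + 1}. 2 * pi * \<i> * res_sum (Phi m n))"
    using S_eq_R[OF m] by (simp flip: sum_distrib_left)
  also have "\<dots> = (\<Sum>n\<in>{- B - 1..B + 1}. contour_integral (\<gamma> n)
      (shifted_W (\<lambda>w. w * (w + of_int (2 * n + e))) (\<lambda>k. m k + n + e - 1) (\<lambda>k. m k - n - 1) (c n) \<alpha>))"
    using contour_integral_shifted_W[OF hol \<gamma> sep] by (intro sum.cong) (simp_all add: res)
  finally show ?thesis by simp
qed

theorem theorem1:
  fixes \<nu> :: real and Nk :: "nat \<Rightarrow> real" and a :: "nat \<Rightarrow> complex"
    and R :: "int \<Rightarrow> real" and g :: "int \<Rightarrow> real \<Rightarrow> complex"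
  assumes "\<nu> = 0 \<or> \<nu> = 1/2"
    and "\<forall>k\<in>{1..6}. Nk k - \<nu> \<in> \<int>"
    and "(\<Sum>k=1..6. Nk k) = 2"
    and "(\<Sum>k=1..6. a k) = 0"
    and "\<forall>n. admissible_contour Nk a (of_int n + \<nu>) (R n) (g n)"
  shows "((\<lambda>n::int. contour_integral_line (F Nk a (of_int n + \<nu>)) (R n) (g n) / (8 * pi * \<i>))
           has_sum
          (\<Prod>(j,k)\<in>{(j,k). 1 \<le> j \<and> j < k \<and> k \<le> (6::nat)}.
             poch_int (1 + (a j + a k - of_real (Nk j) - of_real (Nk k)) / 2) \<lfloor>Nk j + Nk k - 1\<rfloor>)) UNIV"
proof -
  define e :: int where "e = (if \<nu> = 0 then 0 else 1)"
  have e: "e = 0 \<or> e = 1" by (simp add: e_def)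
  have e\<nu>: "2 * \<nu> = of_int e" using assms(1) by (auto simp: e_def)
  define m where "m k = \<lfloor>Nk k - \<nu>\<rfloor>" for k
  have Nk: "Nk k = of_int (m k) + \<nu>" if "k \<in> {1..6}" for k
    using assms(2) that by (auto simp: m_def elim!: Ints_cases dest!: bspec)
  define \<alpha> where "\<alpha> k = (a k - of_real (Nk k)) / 2" for k
  have m: "(\<Sum>k=1..6. m k) = 2 - 3 * e"
  proof -
    have "(\<Sum>k=1..6. Nk k) = (\<Sum>k=1..6. of_int (m k) + \<nu>)" by (intro sum.cong) (auto simp: Nk)
    then have "real_of_int (\<Sum>k=1..6. m k) = of_int (2 - 3 * e)"
      using assms(3) e\<nu> by (simp add: sum.distrib)
    then show ?thesis by linarith
  qed
  have sum_\<alpha>: "(\<Sum>k=1..6. \<alpha> k) = - 1"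
  proof -
    have "(\<Sum>k=1..6. \<alpha> k) = ((\<Sum>k=1..6. a k) - of_real (\<Sum>k=1..6. Nk k)) / 2"
      unfolding \<alpha>_def of_real_sum by (simp add: sum_subtractf flip: sum_divide_distrib)
    then show ?thesis unfolding assms(3,4) by simp
  qed
  define c where "c n = complex_of_real (of_int n + \<nu>)" for n :: int
  have c2: "2 * c n = of_int (2 * n + e)" for n
  proof -
    have "2 * c n = complex_of_real (2 * of_int n + 2 * \<nu>)" by (simp add: c_def)
    then show ?thesis unfolding e\<nu> by simp
  qed
  define p q where "p n k = m k + n + e - 1" and "q n k = m k - n - 1" for n k
  define r where "r n w = w * (w + of_int (2 * n + e))" for n and w :: complex
  have hol: "r n holomorphic_on UNIV" for n
    unfolding r_def by (intro holomorphic_intros)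
  have idx: "\<lfloor>Nk k - 1 + (of_int n + \<nu>)\<rfloor> = p n k" "\<lfloor>Nk k - 1 - (of_int n + \<nu>)\<rfloor> = q n k"
    if "k \<in> {1..6}" for k n
  proof -
    have "Nk k - 1 + (of_int n + \<nu>) = of_int (p n k)"
      using Nk[OF that] e\<nu> by (simp add: p_def)
    then show "\<lfloor>Nk k - 1 + (of_int n + \<nu>)\<rfloor> = p n k" by simp
    have "Nk k - 1 - (of_int n + \<nu>) = of_int (q n k)"
      using Nk[OF that] by (simp add: q_def)
    then show "\<lfloor>Nk k - 1 - (of_int n + \<nu>)\<rfloor> = q n k" by simp
  qed
  have arg: "1 + (a k - of_real (Nk k) + z) / 2 = 1 + \<alpha> k + z / 2"
    "1 + (a k - of_real (Nk k) - z) / 2 = 1 + \<alpha> k - z / 2" for k z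
    by (simp_all add: \<alpha>_def add_divide_distrib diff_divide_distrib)
  have F: "F Nk a (of_int n + \<nu>) = shifted_W (r n) (p n) (q n) (c n) \<alpha>" for n
  proof
    fix y
    have "y\<^sup>2 - (c n)\<^sup>2 = (y - c n) * ((y - c n) + 2 * c n)"
      by (simp add: power2_eq_square algebra_simps)
    then have "y\<^sup>2 - (c n)\<^sup>2 = r n (y - c n)" unfolding c2 r_def .
    then show "F Nk a (of_int n + \<nu>) y = shifted_W (r n) (p n) (q n) (c n) \<alpha> y"
      unfolding F_def shifted_W_def W_def arg c_def[symmetric] by (simp add: idx)
  qed
  have plus: "plus_poles Nk a (of_int n + \<nu>) = (\<lambda>x. x + c n) ` wpoles \<alpha> (p n)" for n
  proof -
    have "plus_poles Nk a (of_int n + \<nu>) = {y. y - c n \<in> wpoles \<alpha> (p n)}"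
      unfolding plus_poles_def wpoles_def arg c_def[symmetric] by (auto simp: idx)
    then show ?thesis by (force simp: image_iff)
  qed
  have minus: "minus_poles Nk a (of_int n + \<nu>) = (\<lambda>x. x + c n) ` uminus ` wpoles \<alpha> (q n)" for n
  proof -
    have z: "1 + \<alpha> k + (- z) / 2 = 1 + \<alpha> k - z / 2" for k z
      by (simp only: minus_divide_left[symmetric] add_uminus_conv_diff)
    have "minus_poles Nk a (of_int n + \<nu>) = {y. - (y - c n) \<in> wpoles \<alpha> (q n)}"
      unfolding minus_poles_def wpoles_def arg c_def[symmetric] mem_Collect_eq z by (auto simp: idx)
    also have "\<dots> = (\<lambda>x. x + c n) ` uminus ` wpoles \<alpha> (q n)"
    proof (intro equalityI subsetI)
      fix y assume "y \<in> {y. - (y - c n) \<in> wpoles \<alpha> (q n)}"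
      then show "y \<in> (\<lambda>x. x + c n) ` uminus ` wpoles \<alpha> (q n)"
        by (intro image_eqI[of _ _ "y - c n"] image_eqI[of _ _ "- (y - c n)"]) auto
    qed auto
    finally show ?thesis .
  qed
  let ?P = "\<lambda>n. (\<lambda>x. x + c n) ` wpoles \<alpha> (p n)"
  let ?M = "\<lambda>n. (\<lambda>x. x + c n) ` uminus ` wpoles \<alpha> (q n)"
  have fin: "finite (?P n)" "finite (?M n)" for n using finite_wpoles by auto
  have g: "valid_path (g n)" "pathstart (g n) = - of_real (R n)" "pathfinish (g n) = of_real (R n)" "0 < R n"
    and above: "\<forall>z\<in>?P n. above_contour (contour_set (R n) (g n)) z"
    and below: "\<forall>z\<in>?M n. below_contour (contour_set (R n) (g n)) z" for n
    using assms(5) unfolding admissible_contour_def plus minus by auto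
  have decay: "((\<lambda>y. y ^ 2 * shifted_W (r n) (p n) (q n) (c n) \<alpha> y) \<longlongrightarrow> 0) at_infinity" for n
    using integrand_shifted_decay[OF m, of \<alpha> n "c n"]
    by (simp add: shifted_W_def integrand_def r_def p_def[abs_def] q_def[abs_def])
  have line: "contour_integral_line (shifted_W (r n) (p n) (q n) (c n) \<alpha>) (R n) (g n) =
      2 * pi * \<i> * (\<Sum>x\<in>?P n. residue (shifted_W (r n) (p n) (q n) (c n) \<alpha>) x)"
    and disjoint: "?P n \<inter> ?M n = {}" for n
    by (rule contour_integral_line_residues[OF g[of n] fin[of n] above[of n] below[of n]
          holomorphic_on_shifted_W[OF hol[of n]] decay[of n]])+
  \<comment> \<open>For each \<open>n\<close> one closed path is fixed from the unperturbed poles.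
    Perturbing on a compact path avoids any uniform control of the infinite tails.\<close>
  have "\<exists>\<gamma>. valid_path \<gamma> \<and> pathfinish \<gamma> = pathstart \<gamma> \<and> separates \<gamma> (?P n) (?M n)" for n
  proof -
    have "\<exists>\<rho>. separates (closed_up (g n) (R n) \<rho> pi) (?P n) (?M n)"
      unfolding separates_def
      by (rule eventually_happens'[OF trivial_limit_at_top_linorder
            eventually_separating[OF g[of n] fin[of n] above[of n] below[of n]]])
    then obtain \<rho> where \<rho>: "separates (closed_up (g n) (R n) \<rho> pi) (?P n) (?M n)" ..
    show ?thesis
      using closed_up_valid[OF g(1-3)[of n], of pi \<rho>] \<rho>
      by (intro exI[of _ "closed_up (g n) (R n) \<rho> pi"] conjI) simp_all
  qed
  then obtain \<gamma> where \<gamma>: "\<And>n. valid_path (\<gamma> n)" "\<And>n. pathfinish (\<gamma> n) = pathstart (\<gamma> n)"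
    "\<And>n. separates (\<gamma> n) (?P n) (?M n)" by metis
  let ?I = "\<lambda>n. contour_integral_line (F Nk a (of_int n + \<nu>)) (R n) (g n)"
  let ?J = "\<lambda>n t. contour_integral (\<gamma> n) (shifted_W (r n) (p n) (q n) (c n) (perturbed \<alpha> t))"
  have line_res: "?I n = 2 * pi * \<i> * (\<Sum>x\<in>?P n. residue (shifted_W (r n) (p n) (q n) (c n) \<alpha>) x)" for n
    unfolding F by (rule line)
  have I_J: "?I n = ?J n 0" for n
  proof -
    have "(\<Sum>x\<in>?P n. residue (shifted_W (r n) (p n) (q n) (c n) \<alpha>) x) =
        (\<Sum>x\<in>wpoles \<alpha> (p n). residue (\<lambda>w. r n w * W \<alpha> (p n) (q n) w) x)"
      by (subst sum.reindex) (auto simp: inj_on_def residue_shifted_W)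
    then show ?thesis
      using contour_integral_shifted_W[OF hol[of n] \<gamma>[of n]] by (simp add: line_res)
  qed
  define B where "B = (\<Sum>k=1..6. \<bar>m k\<bar>)"
  \<comment> \<open>\<alpha> need not be generic here. Either there are no plus poles, or there are
    only plus poles and the sum is over all residues.\<close>
  have zero: "?I n = 0" if n: "n \<notin> {- B - 1..B + 1}" for n
  proof -
    have "(\<forall>k\<in>{1..6}. 0 \<le> p n k) \<or> (\<forall>k\<in>{1..6}. 0 \<le> q n k)"
      using large_index[of n m] n e unfolding B_def p_def q_def by force
    then have "(\<Sum>x\<in>?P n. residue (shifted_W (r n) (p n) (q n) (c n) \<alpha>) x) = 0"
    proof
      assume "\<forall>k\<in>{1..6}. 0 \<le> p n k"
      then have "wpoles \<alpha> (p n) = {}" by (intro wpoles_empty) blast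
      then show ?thesis by simp
    next
      assume "\<forall>k\<in>{1..6}. 0 \<le> q n k"
      then have "wpoles \<alpha> (q n) = {}" by (intro wpoles_empty) blast
      then have h: "shifted_W (r n) (p n) (q n) (c n) \<alpha> holomorphic_on - ?P n"
        using holomorphic_on_shifted_W[OF hol, of n "p n" "q n" "c n" \<alpha>] by simp
      show ?thesis
        by (rule sum_residues_eq_0[OF fin(1) h tendsto_times_from_square[OF decay]])
    qed
    then show ?thesis by (simp add: line_res)
  qed
  \<comment> \<open>For small nonzero \<open>t\<close> the parameters are generic and the finitely
    many paths still separate the poles, so the generic evaluation applies.\<close>
  have "\<forall>\<^sub>F t in at 0. (\<Sum>n\<in>{- B - 1..B + 1}. ?J n t) = 8 * pi * \<i> * pair_product (perturbed \<alpha> t) e m"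
  proof -
    have "\<forall>\<^sub>F t in at 0. \<forall>n\<in>{- B - 1..B + 1}. separates (\<gamma> n) ((\<lambda>x. x + c n) ` wpoles (perturbed \<alpha> t) (p n))
        ((\<lambda>x. x + c n) ` uminus ` wpoles (perturbed \<alpha> t) (q n))"
      using eventually_separates[OF \<gamma>]
      by (intro eventually_ball_finite ballI filter_leD[OF at_within_le_nhds]) auto
    with eventually_generic[OF e sum_\<alpha>] show ?thesis
    proof eventually_elim
      case (elim t)
      show ?case
        using sum_contour_integrals_generic[OF elim(1) m, of \<gamma> c] \<gamma>(1,2) elim(2)
        unfolding B_def[symmetric] r_def[abs_def] p_def[abs_def] q_def[abs_def] by blast
    qed
  qed
  moreover have "((\<lambda>t. \<Sum>n\<in>{- B - 1..B + 1}. ?J n t) \<longlongrightarrow> (\<Sum>n\<in>{- B - 1..B + 1}. ?J n 0)) (at 0)"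
    unfolding perturbed_0
    using \<gamma>(3) unfolding separates_def
    by (intro tendsto_sum contour_integral_shifted_W_tendsto hol \<gamma>(1)) blast
  ultimately have lim: "((\<lambda>t. 8 * pi * \<i> * pair_product (perturbed \<alpha> t) e m) \<longlongrightarrow>
      (\<Sum>n\<in>{- B - 1..B + 1}. ?J n 0)) (at 0)"
    by (rule Lim_transform_eventually[rotated])
  \<comment> \<open>The existence of the contours makes plus and minus poles disjoint for every
    \<open>n\<close>; this is what makes the right-hand side continuous at
    \<open>t = 0\<close>.\<close>
  have "wpoles \<alpha> (\<lambda>k. m k + n + e - 1) \<inter> uminus ` wpoles \<alpha> (\<lambda>k. m k - n - 1) = {}" for n
    using disjoint[of n] unfolding p_def[abs_def] q_def[abs_def] by blast
  then have "((\<lambda>t. pair_product (perturbed \<alpha> t) e m) \<longlongrightarrow> pair_product \<alpha> e m) (at 0)"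
    by (intro pair_product_tendsto pair_product_nonsingular)
  then have "((\<lambda>t. 8 * pi * \<i> * pair_product (perturbed \<alpha> t) e m) \<longlongrightarrow> 8 * pi * \<i> * pair_product \<alpha> e m) (at 0)"
    by (intro tendsto_intros)
  \<comment> \<open>Both sides are limits of the same function of \<open>t\<close>.\<close>
  then have "(\<Sum>n\<in>{- B - 1..B + 1}. ?I n) = 8 * pi * \<i> * pair_product \<alpha> e m"
    unfolding I_J using lim by (intro tendsto_unique[OF _ lim]) auto
  then have "(\<Sum>n\<in>{- B - 1..B + 1}. ?I n / (8 * pi * \<i>)) = pair_product \<alpha> e m"
    by (simp flip: sum_divide_distrib)
  moreover have "pair_product \<alpha> e m = (\<Prod>(j,k)\<in>{(j,k). 1 \<le> j \<and> j < k \<and> k \<le> (6::nat)}.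
      poch_int (1 + (a j + a k - of_real (Nk j) - of_real (Nk k)) / 2) \<lfloor>Nk j + Nk k - 1\<rfloor>)"
    unfolding pair_product_def
  proof (rule prod.cong[OF refl], clarify)
    fix j k :: nat assume jk: "1 \<le> j" "j < k" "k \<le> 6"
    have "Nk j + Nk k - 1 = of_int (m j + m k + e - 1)"
      using Nk[of j] Nk[of k] jk e\<nu> by simp
    then have idx: "\<lfloor>Nk j + Nk k - 1\<rfloor> = m j + m k + e - 1" by simp
    have arg: "1 + (a j + a k - of_real (Nk j) - of_real (Nk k)) / 2 = 1 + \<alpha> j + \<alpha> k"
      by (simp add: \<alpha>_def field_simps)
    show "poch_int (1 + \<alpha> j + \<alpha> k) (m j + m k + e - 1) =
        poch_int (1 + (a j + a k - of_real (Nk j) - of_real (Nk k)) / 2) \<lfloor>Nk j + Nk k - 1\<rfloor>"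
      unfolding idx arg ..
  qed
  ultimately show ?thesis
    using zero by (intro has_sum_finite_neutralI[of "{- B - 1..B + 1}"]) auto
qed

end
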